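(* Let $G$ be a graph, let $k$ be a positive integer, and let $f:V(G)\rightarrow \mathbb{Z}_k$ be a mapping. Assume that $bi(G)\ge k-1$ and that $(k-1)\sum_{v\in V(G)}f(v)$ is even. If $G$ is $(6k-7)$-edge-connected, then $G$ has a spanning subgraph $H$ such that for each vertex $v$, $d_H(v)\equiv f(v) \pmod k$ and $$\left\lfloor \frac{d_G(v)}{2}\right\rfloor-(k-1) \le d_H(v) \le \left\lfloor \frac{d_G(v)}{2}\right\rfloor+k.$$
   Context: Graphs are finite and may have loops and multiple edges; $d_G(v)$ is the degree of $v$ (a loop counts twice). A graph $G$ is $\lambda$-edge-connected if for every nonempty proper subset $A\subset V(G)$ the number of edges with exactly one end in $A$ is at least $\lambda$. $\mathbb{Z}_k$ is the cyclic group of order $k$, with elements represented by integers; the parity of $(k-1)\sum f(v)$ does not depend on the representatives. The bipartite index $bi(G)$ is the minimum of $|E(G)\setminus E(H)|$ over all bipartite spanning subgraphs $H$ of $G$. *)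

theory Defs
  imports Main "HOL-Number_Theory.Cong"
begin

text \<open>
  Undirected graphs with loops and multiple edges: an edge is an abstract name, and
  \<open>ends G e\<close> is the set of its end vertices, which is a singleton exactly if \<open>e\<close> is a loop.
\<close>

record ('v, 'e) multigraph =
  verts :: "'v set"
  edges :: "'e set"
  ends :: "'e \<Rightarrow> 'v set"

locale fin_multigraph =
  fixes G :: "('v, 'e) multigraph"
  assumes finite_verts: "finite (verts G)"
    and finite_edges: "finite (edges G)"
    and ends_subset: "e \<in> edges G \<Longrightarrow> ends G e \<subseteq> verts G"
    and card_ends: "e \<in> edges G \<Longrightarrow> card (ends G e) = 1 \<or> card (ends G e) = 2"

text \<open>The second summand counts each loop a second time.\<close>

definition degree :: "('v, 'e) multigraph \<Rightarrow> 'v \<Rightarrow> nat" where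
  "degree G v = card {e \<in> edges G. v \<in> ends G e} + card {e \<in> edges G. ends G e = {v}}"

definition boundary :: "('v, 'e) multigraph \<Rightarrow> 'v set \<Rightarrow> 'e set" where
  "boundary G A = {e \<in> edges G. ends G e \<inter> A \<noteq> {} \<and> ends G e - A \<noteq> {}}"

text \<open>The parameter is an integer, so that a bound such as \<open>6 * k - 7\<close> is not truncated at \<open>0\<close>.\<close>

definition edge_connected :: "int \<Rightarrow> ('v, 'e) multigraph \<Rightarrow> bool" where
  "edge_connected l G \<longleftrightarrow>
     (\<forall>A. A \<noteq> {} \<and> A \<subset> verts G \<longrightarrow> int (card (boundary G A)) \<ge> l)"

definition spanning_subgraph :: "('v, 'e) multigraph \<Rightarrow> ('v, 'e) multigraph \<Rightarrow> bool" where
  "spanning_subgraph H G \<longleftrightarrow>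
     verts H = verts G \<and> edges H \<subseteq> edges G \<and> (\<forall>e \<in> edges H. ends H e = ends G e)"

definition bipartite :: "('v, 'e) multigraph \<Rightarrow> bool" where
  "bipartite G \<longleftrightarrow>
     (\<exists>X Y. X \<union> Y = verts G \<and> X \<inter> Y = {} \<and>
        (\<forall>e \<in> edges G. \<exists>x \<in> X. \<exists>y \<in> Y. ends G e = {x, y}))"

definition bipartite_index :: "('v, 'e) multigraph \<Rightarrow> nat" where
  "bipartite_index G =
     (LEAST n. \<exists>H. spanning_subgraph H G \<and> bipartite H \<and> n = card (edges G - edges H))"

text \<open>The minimum is attained, as the edgeless spanning subgraph is bipartite.\<close>

lemma bipartite_index_attained:
  "\<exists>H. spanning_subgraph H G \<and> bipartite H \<and> bipartite_index G = card (edges G - edges H)"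
proof -
  let ?H = "\<lparr>verts = verts G, edges = {}, ends = ends G\<rparr>"
  have "spanning_subgraph ?H G" by (simp add: spanning_subgraph_def)
  moreover have "bipartite ?H" by (auto simp: bipartite_def)
  ultimately have "\<exists>n H. spanning_subgraph H G \<and> bipartite H \<and> n = card (edges G - edges H)"
    by blast
  then show ?thesis unfolding bipartite_index_def by (rule LeastI_ex)
qed

end

theory Submission
  imports Defs
begin

text \<open>
  Fix a cut \<open>(Z, verts G - Z)\<close> with the largest number of crossing edges. It contains at least half of the
  edges of every other cut, so its crossing edges form a \<open>(3k - 3)\<close>-edge-connected bipartite graph, and at
  least \<open>k - 1\<close> edges lie inside the parts. Selecting a crossing edge or not is orienting it towards or away
  from \<open>Z\<close>. The inner edges are handled as follows: \<open>k - 1\<close> of them are selected or not in advance, in one of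
  \<open>k\<close> ways that realise all admissible residues of the total; the others are grouped greedily into
  disjoint pairs of adjacent edges of which exactly one is selected, so that a pair \<open>uv, vw\<close> acts like one
  more edge \<open>uw\<close> to be oriented; the edges left over are pairwise disjoint and hence harmless.

  It remains to orient a graph in which some half-edges have a fixed direction, with prescribed
  net out-degrees \<open>\<tau>\<close> modulo \<open>2k\<close> of absolute value below \<open>2k\<close>. Following
  Lovasz, Thomassen, Wu and Zhang, this is possible if every proper nonempty vertex set \<open>A\<close> has degree at
  least \<open>2k - 2 + |\<tau>(A)|\<close>, where \<open>|\<cdot>|\<close> is the distance to \<open>2k\<int>\<close>, and the fixed half-edges
  number at most \<open>2k - 2 + |\<tau>(V)|\<close>. In a smallest counterexample no set with at least two
  vertices is tight (contract it, then treat its complement as fixed), all single vertices are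
  tight (otherwise split off a pair of edges), no vertex has \<open>\<tau>(x) = 0\<close> (such a vertex can be split off
  completely), and an edge joining a residue in \<open>(0, k]\<close> to one in \<open>[k, 2k)\<close> can be oriented and deleted. Up
  to reversal all residues are then in \<open>(0, k)\<close> and all fixed half-edges are incoming, at most
  \<open>2k - 1\<close> of them. An edge can now still be deleted after replacing it at one end by fixed half-edges.
\<close>

section \<open>Distance to the multiples of \<open>2k\<close>\<close>

definition circ_norm :: "int \<Rightarrow> int \<Rightarrow> int" where
  "circ_norm k a = min (a mod (2 * k)) ((- a) mod (2 * k))"

lemma circ_norm_cong: "[a = b] (mod 2 * k) \<Longrightarrow> circ_norm k a = circ_norm k b"
  unfolding circ_norm_def cong_def by (metis mod_minus_cong)

lemma circ_norm_minus [simp]: "circ_norm k (- a) = circ_norm k a"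
  by (simp add: circ_norm_def min.commute)

lemma circ_norm_eq:
  assumes "k \<ge> 1"
  shows "circ_norm k a = (if a mod (2 * k) \<le> k then a mod (2 * k) else 2 * k - a mod (2 * k))"
proof (cases "a mod (2 * k) = 0")
  case True
  then show ?thesis using assms by (simp add: circ_norm_def zmod_zminus1_eq_if)
next
  case False
  then show ?thesis using assms by (auto simp add: circ_norm_def zmod_zminus1_eq_if)
qed

text \<open>The triangle inequality below is carried over from the integers through such a
  representative of least absolute value.\<close>

lemma circ_norm_rep:
  assumes "k \<ge> 1"
  obtains b where "[b = a] (mod 2 * k)" "\<bar>b\<bar> = circ_norm k a"
proof (cases "a mod (2 * k) \<le> k")
  case True
  have "0 \<le> a mod (2 * k)" using assms by simp
  then show ?thesis using that[of "a mod (2 * k)"] True assms by (simp add: circ_norm_eq cong_def)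
next
  case False
  have "a mod (2 * k) < 2 * k" using assms by simp
  then show ?thesis using that[of "a mod (2 * k) - 2 * k"] False assms \<open>a mod (2 * k) < 2 * k\<close>
    by (simp add: circ_norm_eq cong_def mod_diff_eq[symmetric])
qed

lemma circ_norm_nonneg: "k \<ge> 1 \<Longrightarrow> 0 \<le> circ_norm k a"
  by (simp add: circ_norm_def)

lemma circ_norm_le: "k \<ge> 1 \<Longrightarrow> circ_norm k a \<le> k"
  by (simp add: circ_norm_eq)

lemma circ_norm_le_abs:
  assumes "k \<ge> 1"
  shows "circ_norm k a \<le> \<bar>a\<bar>"
proof (cases "a \<ge> 0")
  case True
  then have "a mod (2 * k) \<le> a" by (simp add: zmod_le_nonneg_dividend)
  then show ?thesis using True by (simp add: circ_norm_def)
next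
  case False
  then have "(- a) mod (2 * k) \<le> - a" by (simp add: zmod_le_nonneg_dividend)
  then show ?thesis using False by (simp add: circ_norm_def)
qed

lemma circ_norm_small: "k \<ge> 1 \<Longrightarrow> 0 \<le> a \<Longrightarrow> a \<le> k \<Longrightarrow> circ_norm k a = a"
  by (simp add: circ_norm_eq)

lemma circ_norm_triangle:
  assumes "k \<ge> 1"
  shows "circ_norm k (a + b) \<le> circ_norm k a + circ_norm k b"
proof -
  obtain a' where a: "[a' = a] (mod 2 * k)" "\<bar>a'\<bar> = circ_norm k a" using circ_norm_rep[OF assms] by blast
  obtain b' where b: "[b' = b] (mod 2 * k)" "\<bar>b'\<bar> = circ_norm k b" using circ_norm_rep[OF assms] by blast
  have "circ_norm k (a + b) = circ_norm k (a' + b')" by (rule circ_norm_cong) (use a b cong_add cong_sym in blast)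
  also have "\<dots> \<le> \<bar>a' + b'\<bar>" by (rule circ_norm_le_abs[OF assms])
  also have "\<dots> \<le> circ_norm k a + circ_norm k b" using a b by linarith
  finally show ?thesis .
qed

lemma circ_norm_add_le: "k \<ge> 1 \<Longrightarrow> circ_norm k (a + d) \<le> circ_norm k a + \<bar>d\<bar>"
  using circ_norm_triangle[of k a d] circ_norm_le_abs[of k d] by linarith

lemma even_circ_norm_iff:
  assumes "k \<ge> 1"
  shows "even (circ_norm k a) \<longleftrightarrow> even a"
proof -
  have "even (a mod (2 * k)) \<longleftrightarrow> even a" by (simp add: dvd_mod_iff)
  then show ?thesis using assms by (simp add: circ_norm_eq)
qed

lemma circ_norm_eq_0_iff: "k \<ge> 1 \<Longrightarrow> circ_norm k a = 0 \<longleftrightarrow> a mod (2 * k) = 0"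
  using pos_mod_bound[of "2 * k" a] by (simp add: circ_norm_eq del: pos_mod_bound)

text \<open>Together with \<open>circ_norm_add_1\<close> this tells in which half of the circle a
  unit step leads towards 0. At the antipode \<open>k\<close> both directions do.\<close>

lemma circ_norm_diff_1:
  assumes "k \<ge> 1" "0 < a mod (2 * k)" "a mod (2 * k) \<le> k"
  shows "circ_norm k (a - 1) = circ_norm k a - 1"
proof -
  have "circ_norm k (a - 1) = circ_norm k (a mod (2 * k) - 1)"
    by (rule circ_norm_cong) (simp add: cong_def mod_simps)
  then show ?thesis using assms by (simp add: circ_norm_small circ_norm_eq)
qed

lemma circ_norm_add_1:
  assumes "k \<ge> 1" "k \<le> a mod (2 * k)"
  shows "circ_norm k (a + 1) = circ_norm k a - 1"
proof -
  have lt: "a mod (2 * k) < 2 * k" using assms by simp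
  have "[a + 1 = a mod (2 * k) - 2 * k + 1] (mod 2 * k)"
    by (rule cong_add) (auto simp: cong_def)
  then have "circ_norm k (a + 1) = circ_norm k (a mod (2 * k) - 2 * k + 1)"
    by (rule circ_norm_cong)
  also have "\<dots> = circ_norm k (2 * k - 1 - a mod (2 * k))"
    by (metis (no_types, opaque_lifting) circ_norm_minus minus_diff_eq diff_diff_eq2 diff_add_eq add.commute)
  also have "\<dots> = 2 * k - 1 - a mod (2 * k)"
    by (rule circ_norm_small) (use assms lt in auto)
  finally show ?thesis using assms by (simp add: circ_norm_eq)
qed

text \<open>If \<open>\<bar>a\<bar> \<ge> 2 * k\<close>, then moving \<open>a\<close> by
  \<open>2 * k\<close> towards 0 bounds its norm by \<open>\<bar>a\<bar> - 2 * k\<close>, which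
  contradicts the assumption. This turns a degree bound into the bound that \<open>solvable\<close>
  demands.\<close>

lemma abs_le_of_circ_norm:
  assumes "k \<ge> 1" "\<bar>a\<bar> \<le> 2 * k - 2 + circ_norm k a"
  shows "\<bar>a\<bar> \<le> 2 * k - 1"
proof (rule ccontr)
  assume neg: "\<not> ?thesis"
  define b where "b = (if a \<ge> 0 then a - 2 * k else a + 2 * k)"
  have "[a = b] (mod 2 * k)" by (auto simp: b_def cong_def)
  then have "circ_norm k a \<le> \<bar>b\<bar>" using circ_norm_cong circ_norm_le_abs[OF assms(1)] by metis
  then show False using neg assms(2) by (auto simp: b_def split: if_splits)
qed

section \<open>Sums after a change at one vertex\<close>

lemma sum_upd:
  fixes f :: "'a \<Rightarrow> int"
  assumes "finite A"
  shows "sum (f(x := f x + d)) A = sum f A + of_bool (x \<in> A) * d"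
proof (cases "x \<in> A")
  case True
  then show ?thesis using assms
    by (simp add: sum.remove[OF assms True] sum.cong[of "A - {x}" _ "f(x := f x + d)" f])
next
  case False
  then have "sum (f(x := f x + d)) A = sum f A" by (intro sum.cong) auto
  then show ?thesis using False by simp
qed

lemma sum_upd_diff:
  fixes f :: "'a \<Rightarrow> int"
  shows "finite A \<Longrightarrow> sum (f(x := f x - d)) A = sum f A - of_bool (x \<in> A) * d"
  using sum_upd[of A f x "- d"] by simp

lemma sum_of_bool_eq:
  "finite B \<Longrightarrow> (\<Sum>v\<in>B. of_bool (u = v \<and> C)) = (of_bool (u \<in> B \<and> C) :: int)"
  by (cases C) (auto simp: of_bool_def)

section \<open>Orientations with net out-degrees prescribed modulo \<open>2k\<close>\<close>

definition cut_size :: "'e set \<Rightarrow> ('e \<Rightarrow> 'v) \<Rightarrow> ('e \<Rightarrow> 'v) \<Rightarrow> 'v set \<Rightarrow> int" where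
  "cut_size E t h A = (\<Sum>e\<in>E. of_bool ((t e \<in> A) \<noteq> (h e \<in> A)))"

text \<open>The sign \<open>s e\<close> is 1 if \<open>e\<close> keeps its reference direction and
  -1 if it is reversed, so this is the number of edges leaving \<open>A\<close> minus the number
  entering it. Loops cancel.\<close>

definition net_out :: "'e set \<Rightarrow> ('e \<Rightarrow> 'v) \<Rightarrow> ('e \<Rightarrow> 'v) \<Rightarrow> ('e \<Rightarrow> int) \<Rightarrow> 'v set \<Rightarrow> int" where
  "net_out E t h s A = (\<Sum>e\<in>E. s e * (of_bool (t e \<in> A) - of_bool (h e \<in> A)))"

definition cut_degree :: "'e set \<Rightarrow> ('e \<Rightarrow> 'v) \<Rightarrow> ('e \<Rightarrow> 'v) \<Rightarrow> ('v \<Rightarrow> int) \<Rightarrow> ('v \<Rightarrow> int) \<Rightarrow> 'v set \<Rightarrow> int" where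
  "cut_degree E t h p q A = cut_size E t h A + sum p A + sum q A"

text \<open>
  The edges of \<open>E\<close>, with reference direction from \<open>t e\<close> to \<open>h e\<close>, are still to be oriented, whereas \<open>p x\<close> and \<open>q x\<close> count
  the half-edges at \<open>x\<close> that are fixed as outgoing and incoming. They play the role of the edges at the preoriented
  vertex \<open>z\<^sub>0\<close> of Lovasz et al. The set \<open>Z\<close> is empty or consists of one vertex that is being split off and is
  exempt from the degree condition.
\<close>

definition mod_instance where
  "mod_instance k X E t h p q \<tau> Z \<longleftrightarrow>
     finite X \<and> finite E \<and> k \<ge> (1::int) \<and> (\<forall>e\<in>E. t e \<in> X \<and> h e \<in> X) \<and>
     (\<forall>x\<in>X. 0 \<le> p x \<and> 0 \<le> q x) \<and>
     (\<forall>A\<subseteq>X. even (sum \<tau> A) \<longleftrightarrow> even (cut_degree E t h p q A)) \<and>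
     [sum \<tau> X = sum p X - sum q X] (mod 2 * k) \<and>
     (\<forall>A. A \<noteq> {} \<and> A \<subset> X \<and> A \<noteq> Z \<longrightarrow> 2 * k - 2 + circ_norm k (sum \<tau> A) \<le> cut_degree E t h p q A) \<and>
     sum p X + sum q X \<le> 2 * k - 2 + circ_norm k (sum \<tau> X) \<and>
     (Z = {} \<or> (\<exists>x\<in>X. Z = {x} \<and> circ_norm k (\<tau> x) = 0))"

text \<open>The congruence fixes the residue of each net out-degree; the second condition leaves at
  most two values in each residue class and later yields the degree bounds of the subgraph.\<close>

definition solvable where
  "solvable k X E t h p q \<tau> \<longleftrightarrow>
     (\<exists>s. (\<forall>e. s e = 1 \<or> s e = - 1) \<and>
       (\<forall>x\<in>X. [net_out E t h s {x} + p x - q x = \<tau> x] (mod 2 * k) \<and>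
              \<bar>net_out E t h s {x} + p x - q x\<bar> \<le> 2 * k - 1))"

lemma cut_size_nonneg: "0 \<le> cut_size E t h A"
  by (simp add: cut_size_def sum_nonneg)

lemma abs_net_out_le:
  assumes "\<forall>e. s e = 1 \<or> s e = (- 1 :: int)"
  shows "\<bar>net_out E t h s A\<bar> \<le> cut_size E t h A"
proof -
  have "\<bar>net_out E t h s A\<bar> \<le> (\<Sum>e\<in>E. \<bar>s e * (of_bool (t e \<in> A) - of_bool (h e \<in> A))\<bar>)"
    unfolding net_out_def by (rule sum_abs)
  also have "\<dots> \<le> cut_size E t h A"
    unfolding cut_size_def
  proof (rule sum_mono)
    fix e show "\<bar>s e * (of_bool (t e \<in> A) - of_bool (h e \<in> A))\<bar> \<le> of_bool ((t e \<in> A) \<noteq> (h e \<in> A))"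
      using spec[OF assms, of e] by auto
  qed
  finally show ?thesis .
qed

section \<open>Reversal, single edges and tight vertices\<close>

text \<open>Reversing every direction exchanges the outgoing and incoming half-edges and negates the
  targets. With \<open>solvable_reverse\<close> this halves the later case distinctions.\<close>

lemma mod_instance_reverse:
  assumes "mod_instance k X E t h p q \<tau> Z"
  shows "mod_instance k X E t h q p (\<lambda>v. - \<tau> v) Z"
proof -
  have v: "cut_degree E t h q p A = cut_degree E t h p q A" for A by (simp add: cut_degree_def)
  have "[sum \<tau> X = sum p X - sum q X] (mod 2 * k)" using assms by (simp add: mod_instance_def)
  then have "[- sum \<tau> X = sum q X - sum p X] (mod 2 * k)"
    using cong_minus_minus_iff[of "sum \<tau> X" "sum p X - sum q X" "2 * k"] by simp
  then show ?thesis using assms by (auto simp: mod_instance_def v sum_negf add.commute)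
qed

lemma solvable_reverse:
  assumes "solvable k X E t h q p (\<lambda>v. - \<tau> v)"
  shows "solvable k X E t h p q \<tau>"
proof -
  obtain s where s: "\<And>e. s e = 1 \<or> s e = - 1"
    and sol: "\<And>x. x \<in> X \<Longrightarrow> [net_out E t h s {x} + q x - p x = - \<tau> x] (mod 2 * k) \<and>
              \<bar>net_out E t h s {x} + q x - p x\<bar> \<le> 2 * k - 1"
    using assms unfolding solvable_def by blast
  have n: "net_out E t h (\<lambda>e. - s e) A = - net_out E t h s A" for A
    by (simp add: net_out_def sum_negf)
  show ?thesis unfolding solvable_def
  proof (intro exI[of _ "\<lambda>e. - s e"] conjI ballI allI)
    fix e show "- s e = 1 \<or> - s e = - 1" using s[of e] by auto
  next
    fix x assume "x \<in> X"
    then have "[- (net_out E t h s {x} + q x - p x) = \<tau> x] (mod 2 * k)"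
      using sol cong_minus_minus_iff by (metis add.inverse_inverse)
    then show "[net_out E t h (\<lambda>e. - s e) {x} + p x - q x = \<tau> x] (mod 2 * k)"
      by (simp add: n algebra_simps)
    show "\<bar>net_out E t h (\<lambda>e. - s e) {x} + p x - q x\<bar> \<le> 2 * k - 1"
      using sol[OF \<open>x \<in> X\<close>] unfolding n by linarith
  qed
qed

text \<open>Adjacency without regard to the reference direction. Loops are left out, as they cross
  no cut and change no net out-degree.\<close>

definition joins where
  "joins t h e x y \<longleftrightarrow> x \<noteq> y \<and> (t e = x \<and> h e = y \<or> t e = y \<and> h e = x)"

lemma joins_sym: "joins t h e x y \<Longrightarrow> joins t h e y x"
  by (auto simp: joins_def)

text \<open>For an end \<open>y\<close> of a non-loop \<open>e\<close>, this is the sign that makes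
  \<open>e\<close> leave \<open>y\<close>, whatever its reference direction.\<close>

definition dir_sign :: "('e \<Rightarrow> 'v) \<Rightarrow> 'e \<Rightarrow> 'v \<Rightarrow> int" where
  "dir_sign t e y = (if t e = y then 1 else - 1)"

lemma dir_sign_cases: "dir_sign t e y = 1 \<or> dir_sign t e y = - 1"
  by (simp add: dir_sign_def)

lemma dir_sign_mult:
  assumes "joins t h e y x"
  shows "dir_sign t e y * (of_bool (t e \<in> A) - of_bool (h e \<in> A)) = of_bool (y \<in> A) - of_bool (x \<in> A)"
  using assms by (auto simp: joins_def dir_sign_def)

lemma cut_size_delete:
  assumes "finite E" "e \<in> E" "joins t h e y x"
  shows "cut_size (E - {e}) t h A = cut_size E t h A - of_bool ((y \<in> A) \<noteq> (x \<in> A))"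
proof -
  have "(t e \<in> A) \<noteq> (h e \<in> A) \<longleftrightarrow> (y \<in> A) \<noteq> (x \<in> A)" using assms(3) by (auto simp: joins_def)
  then show ?thesis unfolding cut_size_def sum.remove[OF assms(1,2)] by simp
qed

lemma net_out_delete:
  assumes "finite E" "e \<in> E" "joins t h e y x"
  shows "net_out E t h (s(e := dir_sign t e y)) A = net_out (E - {e}) t h s A + of_bool (y \<in> A) - of_bool (x \<in> A)"
proof -
  let ?s = "s(e := dir_sign t e y)"
  have "(\<Sum>e'\<in>E - {e}. ?s e' * (of_bool (t e' \<in> A) - of_bool (h e' \<in> A))) = net_out (E - {e}) t h s A"
    unfolding net_out_def by (rule sum.cong) auto
  then show ?thesis unfolding net_out_def[of E] sum.remove[OF assms(1,2)]
    by (simp add: dir_sign_mult[OF assms(3)])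
qed

lemma
  assumes "mod_instance k X E t h p q \<tau> Z"
  shows mod_instance_finite: "finite X" "finite E"
    and mod_instance_k: "k \<ge> 1"
    and mod_instance_ends: "e \<in> E \<Longrightarrow> t e \<in> X \<and> h e \<in> X"
    and mod_instance_nonneg: "x \<in> X \<Longrightarrow> 0 \<le> p x \<and> 0 \<le> q x"
    and mod_instance_parity: "A \<subseteq> X \<Longrightarrow> even (sum \<tau> A) \<longleftrightarrow> even (cut_degree E t h p q A)"
    and mod_instance_total: "[sum \<tau> X = sum p X - sum q X] (mod 2 * k)"
    and mod_instance_ge: "A \<noteq> {} \<Longrightarrow> A \<subset> X \<Longrightarrow> A \<noteq> Z \<Longrightarrow> 2 * k - 2 + circ_norm k (sum \<tau> A) \<le> cut_degree E t h p q A"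
    and mod_instance_le: "sum p X + sum q X \<le> 2 * k - 2 + circ_norm k (sum \<tau> X)"
    and mod_instance_exempt: "Z = {} \<or> (\<exists>x\<in>X. Z = {x} \<and> circ_norm k (\<tau> x) = 0)"
  using assms unfolding mod_instance_def by blast+

lemma mod_instanceI:
  assumes "finite X" "finite E" "k \<ge> 1" "\<And>e. e \<in> E \<Longrightarrow> t e \<in> X \<and> h e \<in> X"
    "\<And>x. x \<in> X \<Longrightarrow> 0 \<le> p x \<and> 0 \<le> q x"
    "\<And>A. A \<subseteq> X \<Longrightarrow> even (sum \<tau> A) \<longleftrightarrow> even (cut_degree E t h p q A)"
    "[sum \<tau> X = sum p X - sum q X] (mod 2 * k)"
    "\<And>A. A \<noteq> {} \<Longrightarrow> A \<subset> X \<Longrightarrow> A \<noteq> Z \<Longrightarrow> 2 * k - 2 + circ_norm k (sum \<tau> A) \<le> cut_degree E t h p q A"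
    "sum p X + sum q X \<le> 2 * k - 2 + circ_norm k (sum \<tau> X)"
    "Z = {} \<or> (\<exists>x\<in>X. Z = {x} \<and> circ_norm k (\<tau> x) = 0)"
  shows "mod_instance k X E t h p q \<tau> Z"
proof -
  have "\<forall>e\<in>E. t e \<in> X \<and> h e \<in> X" using assms(4) by blast
  moreover have "\<forall>x\<in>X. 0 \<le> p x \<and> 0 \<le> q x" using assms(5) by blast
  moreover have "\<forall>A\<subseteq>X. even (sum \<tau> A) \<longleftrightarrow> even (cut_degree E t h p q A)" using assms(6) by blast
  moreover have "\<forall>A. A \<noteq> {} \<and> A \<subset> X \<and> A \<noteq> Z \<longrightarrow> 2 * k - 2 + circ_norm k (sum \<tau> A) \<le> cut_degree E t h p q A"
    using assms(8) by blast
  ultimately show ?thesis unfolding mod_instance_def using assms(1,2,3,7,9,10) by (intro conjI)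
qed

lemma solvableI:
  assumes "\<forall>e. s e = 1 \<or> s e = (- 1 :: int)"
    "\<And>x. x \<in> X \<Longrightarrow> [net_out E t h s {x} + p x - q x = \<tau> x] (mod 2 * k)"
    "\<And>x. x \<in> X \<Longrightarrow> \<bar>net_out E t h s {x} + p x - q x\<bar> \<le> 2 * k - 1"
  shows "solvable k X E t h p q \<tau>"
  using assms unfolding solvable_def by blast

text \<open>The net out-degree of a vertex is at most its cut degree. If all vertices are tight,
  \<open>abs_le_of_circ_norm\<close> therefore gives the required bounds, and only the congruences
  have to be checked.\<close>

lemma solvableI_tight:
  assumes "mod_instance k X E t h p q \<tau> Z"
    and s: "\<forall>e. s e = 1 \<or> s e = (- 1 :: int)"
    and c: "\<And>x. x \<in> X \<Longrightarrow> [net_out E t h s {x} + p x - q x = \<tau> x] (mod 2 * k)"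
    and tight: "\<And>v. v \<in> X \<Longrightarrow> cut_degree E t h p q {v} \<le> 2 * k - 2 + circ_norm k (\<tau> v)"
  shows "solvable k X E t h p q \<tau>"
proof (rule solvableI[OF s c])
  fix x assume x: "x \<in> X"
  let ?n = "net_out E t h s {x} + p x - q x"
  have "\<bar>?n\<bar> \<le> cut_degree E t h p q {x}"
    using abs_net_out_le[OF s, of E t h "{x}"] mod_instance_nonneg[OF assms(1) x] by (simp add: cut_degree_def) linarith
  also have "\<dots> \<le> 2 * k - 2 + circ_norm k ?n"
    using tight[OF x] circ_norm_cong[OF c[OF x]] by simp
  finally show "\<bar>?n\<bar> \<le> 2 * k - 1" by (rule abs_le_of_circ_norm[OF mod_instance_k[OF assms(1)]])
qed

section \<open>Local reductions: deleting and splitting off edges and half-edges\<close>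

lemma card_cases:
  assumes "finite A" "A \<noteq> {}"
  obtains v where "A = {v}" | "card A \<ge> 2"
proof -
  have "card A \<noteq> 0" using assms by simp
  then consider "card A = 1" | "card A \<ge> 2" by linarith
  then show ?thesis using that by cases (auto simp: card_1_singleton_iff)
qed

text \<open>
  The edge \<open>e\<close> is oriented from \<open>y\<close> to \<open>x\<close> and deleted. If \<open>b = 1\<close>, then it is kept at \<open>x\<close> as a fixed
  incoming half-edge. Moreover, \<open>a\<close> fixed outgoing half-edges are added at \<open>x\<close>.
\<close>

lemma edge_update:
  fixes k a b :: int
  assumes mod_instance: "mod_instance k X E t h p q \<tau> {}"
    and e: "e \<in> E" "joins t h e y x"
    and ab: "a \<ge> 0" "b = 0 \<or> b = 1"
    and slack: "\<And>A. A \<subset> X \<Longrightarrow> card A \<ge> 2 \<Longrightarrow> 2 * k + circ_norm k (sum \<tau> A) \<le> cut_degree E t h p q A"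
    and ey: "circ_norm k (\<tau> y - 1) = circ_norm k (\<tau> y) - 1"
    and ex: "2 * k - 2 + circ_norm k (\<tau> x + (1 - b + a)) \<le> cut_degree E t h p q {x} - 1 + a + b"
    and eX: "sum p X + sum q X + a + b \<le> 2 * k - 2 + circ_norm k (sum \<tau> X - b + a)"
    and tight: "\<And>v. v \<in> X \<Longrightarrow> cut_degree E t h p q {v} \<le> 2 * k - 2 + circ_norm k (\<tau> v)"
    and new: "\<And>p' q' \<tau>'. mod_instance k X (E - {e}) t h p' q' \<tau>' {} \<Longrightarrow> sum p' X + sum q' X = sum p X + sum q X + a + b \<Longrightarrow>
        solvable k X (E - {e}) t h p' q' \<tau>'"
  shows "solvable k X E t h p q \<tau>"
proof -
  note fin = mod_instance_finite[OF mod_instance] and k = mod_instance_k[OF mod_instance]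
  have xy: "x \<noteq> y" and xX: "x \<in> X" and yX: "y \<in> X"
    using e mod_instance_ends[OF mod_instance, of e] by (auto simp: joins_def)
  define p' where "p' = p(x := p x + a)"
  define q' where "q' = q(x := q x + b)"
  \<comment> \<open>Without \<open>e\<close>, which entered \<open>x\<close> and left
    \<open>y\<close>, the target rises by 1 at \<open>x\<close> and falls by 1 at \<open>y\<close>.
    The new half-edges at \<open>x\<close> shift its target by \<open>a - b\<close>.\<close>
  define \<sigma> where "\<sigma> = \<tau>(x := \<tau> x + (1 - b + a))"
  define \<tau>' where "\<tau>' = \<sigma>(y := \<sigma> y  - 1)"
  have sp: "sum p' A = sum p A + of_bool (x \<in> A) * a" 
    and sq: "sum q' A = sum q A + of_bool (x \<in> A) * b" 
    and st: "sum \<tau>' A = sum \<tau> A + of_bool (x \<in> A) * (1 - b + a) - of_bool (y \<in> A)" if "finite A" for A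
    using that by (simp_all add: p'_def q'_def \<tau>'_def \<sigma>_def sum_upd sum_upd_diff del: fun_upd_apply)
  have v': "cut_degree (E - {e}) t h p' q' A = cut_degree E t h p q A - of_bool ((y \<in> A) \<noteq> (x \<in> A)) + of_bool (x \<in> A) * (a + b)"
    if "finite A" for A
    using that by (simp add: cut_degree_def sp sq cut_size_delete[OF fin(2) e] algebra_simps)
  have "mod_instance k X (E - {e}) t h p' q' \<tau>' {}"
  proof (rule mod_instanceI)
    show "finite X" "finite (E - {e})" "k \<ge> 1" using fin k by auto
    show "t e' \<in> X \<and> h e' \<in> X" if "e' \<in> E - {e}" for e' using that mod_instance_ends[OF mod_instance] by blast
    show "0 \<le> p' v \<and> 0 \<le> q' v" if "v \<in> X" for v
      using mod_instance_nonneg[OF mod_instance that] ab by (auto simp: p'_def q'_def)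
    show "even (sum \<tau>' A) \<longleftrightarrow> even (cut_degree (E - {e}) t h p' q' A)" if "A \<subseteq> X" for A
      using finite_subset[OF that fin(1)] mod_instance_parity[OF mod_instance that] ab
      by (auto simp: st v')
    have "[sum \<tau> X + (a - b) = sum p X - sum q X + (a - b)] (mod 2 * k)"
      by (rule cong_add[OF mod_instance_total[OF mod_instance] cong_refl])
    then show "[sum \<tau>' X = sum p' X - sum q' X] (mod 2 * k)"
      using fin xX yX by (simp add: sp sq st algebra_simps)
    show "sum p' X + sum q' X \<le> 2 * k - 2 + circ_norm k (sum \<tau>' X)"
      using eX fin xX yX by (simp add: sp sq st algebra_simps)
    fix A assume A: "A \<noteq> {}" "A \<subset> X"
    then have fA: "finite A" using finite_subset fin(1) by blast
    note ge = mod_instance_ge[OF mod_instance A(1) A(2) A(1)]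
    from fA A(1) show "2 * k - 2 + circ_norm k (sum \<tau>' A) \<le> cut_degree (E - {e}) t h p' q' A"
    proof (cases rule: card_cases)
      case (1 v)
      consider "v = x" | "v = y" | "v \<noteq> x" "v \<noteq> y" by blast
      then show ?thesis
        using 1 xy ex ey ge by cases (simp_all add: \<tau>'_def \<sigma>_def v' algebra_simps)
    next
      case 2
      \<comment> \<open>The slack of 2 covers each position of \<open>x\<close> and
        \<open>y\<close>. In the case \<open>x \<in> A\<close>, \<open>y \<notin> A\<close>, for
        example, the degree changes by \<open>a + b - 1\<close> while the norm grows by at most
        \<open>1 - b + a\<close>.\<close>
      note sl = slack[OF A(2) 2]
      show ?thesis
        using sl ab circ_norm_add_le[OF k, of "sum \<tau> A" "1 - b + a"] circ_norm_add_le[OF k, of "sum \<tau> A" "a - b"]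
          circ_norm_add_le[OF k, of "sum \<tau> A" "- 1"]
        by (cases "x \<in> A"; cases "y \<in> A") (auto simp: st v' fA algebra_simps)
    qed
  qed simp
  from new[OF this] have "solvable k X (E - {e}) t h p' q' \<tau>'"
    using fin xX by (simp add: sp sq)
  then obtain s where s: "\<forall>e. s e = 1 \<or> s e = (- 1 :: int)"
    and c: "\<And>v. v \<in> X \<Longrightarrow> [net_out (E - {e}) t h s {v} + p' v - q' v = \<tau>' v] (mod 2 * k)"
    unfolding solvable_def by blast
  show ?thesis
  proof (rule solvableI_tight[OF mod_instance _ _ tight])
    show "\<forall>e'. (s(e := dir_sign t e y)) e' = 1 \<or> (s(e := dir_sign t e y)) e' = - 1" using s dir_sign_cases[of t e y] by simp
    fix v assume v: "v \<in> X"
    let ?d = "of_bool (v = y) - of_bool (v = x) * (1 - b + a)"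
    have "[net_out (E - {e}) t h s {v} + p' v - q' v + ?d = \<tau>' v + ?d] (mod 2 * k)"
      by (rule cong_add[OF c[OF v] cong_refl])
    then show "[net_out E t h (s(e := dir_sign t e y)) {v} + p v - q v = \<tau> v] (mod 2 * k)"
      using xy by (cases "v = x"; cases "v = y")
        (auto simp: net_out_delete[OF fin(2) e] p'_def q'_def \<tau>'_def \<sigma>_def algebra_simps)
  qed
qed

text \<open>Deleting a fixed outgoing half-edge at \<open>x\<close> costs one unit of degree, and
  \<open>ex\<close> says that the norm of the target at \<open>x\<close> drops by one as well. So
  the condition at \<open>x\<close> survives, and larger sets have slack.\<close>

lemma stub_update:
  fixes k :: int
  assumes mod_instance: "mod_instance k X E t h p q \<tau> {}" and x: "x \<in> X" "p x > 0"
    and slack: "\<And>A. A \<subset> X \<Longrightarrow> card A \<ge> 2 \<Longrightarrow> 2 * k + circ_norm k (sum \<tau> A) \<le> cut_degree E t h p q A"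
    and ex: "circ_norm k (\<tau> x - 1) = circ_norm k (\<tau> x) - 1"
    and tight: "\<And>v. v \<in> X \<Longrightarrow> cut_degree E t h p q {v} \<le> 2 * k - 2 + circ_norm k (\<tau> v)"
    and new: "\<And>p' \<tau>'. mod_instance k X E t h p' q \<tau>' {} \<Longrightarrow> sum p' X = sum p X - 1 \<Longrightarrow>
        solvable k X E t h p' q \<tau>'"
  shows "solvable k X E t h p q \<tau>"
proof -
  note fin = mod_instance_finite[OF mod_instance] and k = mod_instance_k[OF mod_instance]
  define p' where "p' = p(x := p x  - 1)"
  define \<tau>' where "\<tau>' = \<tau>(x := \<tau> x  - 1)"
  have sp: "sum p' A = sum p A - of_bool (x \<in> A)" 
    and st: "sum \<tau>' A = sum \<tau> A - of_bool (x \<in> A)" if "finite A" for A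
    using that by (simp_all add: p'_def \<tau>'_def sum_upd sum_upd_diff del: fun_upd_apply)
  have v': "cut_degree E t h p' q A = cut_degree E t h p q A - of_bool (x \<in> A)"
    if "finite A" for A
    using that by (simp add: cut_degree_def sp)
  have "mod_instance k X E t h p' q \<tau>' {}"
  proof (rule mod_instanceI)
    show "finite X" "finite E" "k \<ge> 1" using fin k by auto
    show "t e' \<in> X \<and> h e' \<in> X" if "e' \<in> E" for e' using that mod_instance_ends[OF mod_instance] by blast
    show "0 \<le> p' v \<and> 0 \<le> q v" if "v \<in> X" for v
      using mod_instance_nonneg[OF mod_instance that] x by (auto simp: p'_def)
    show "even (sum \<tau>' A) \<longleftrightarrow> even (cut_degree E t h p' q A)" if "A \<subseteq> X" for A
      using finite_subset[OF that fin(1)] mod_instance_parity[OF mod_instance that]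
      by (auto simp: st v')
    have "[sum \<tau> X + - 1 = sum p X - sum q X + - 1] (mod 2 * k)"
      by (rule cong_add[OF mod_instance_total[OF mod_instance] cong_refl])
    then show "[sum \<tau>' X = sum p' X - sum q X] (mod 2 * k)"
      using fin x by (simp add: sp st algebra_simps)
    show "sum p' X + sum q X \<le> 2 * k - 2 + circ_norm k (sum \<tau>' X)"
      using mod_instance_le[OF mod_instance] circ_norm_add_le[OF k, of "sum \<tau> X - 1" 1] fin x by (simp add: sp st)
    fix A assume A: "A \<noteq> {}" "A \<subset> X"
    then have fA: "finite A" using finite_subset fin(1) by blast
    note ge = mod_instance_ge[OF mod_instance A(1) A(2) A(1)]
    from fA A(1) show "2 * k - 2 + circ_norm k (sum \<tau>' A) \<le> cut_degree E t h p' q A"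
    proof (cases rule: card_cases)
      case (1 v)
      then show ?thesis using ex ge by (cases "v = x") (simp_all add: \<tau>'_def v')
    next
      case 2
      show ?thesis using slack[OF A(2) 2] circ_norm_add_le[OF k, of "sum \<tau> A" "- 1"]
        by (simp add: st v' fA)
    qed
  qed simp
  from new[OF this] have "solvable k X E t h p' q \<tau>'"
    using fin x by (simp add: sp)
  then obtain s where s: "\<forall>e. s e = 1 \<or> s e = (- 1 :: int)"
    and c: "\<And>v. v \<in> X \<Longrightarrow> [net_out E t h s {v} + p' v - q v = \<tau>' v] (mod 2 * k)"
    unfolding solvable_def by blast
  show ?thesis
  proof (rule solvableI_tight[OF mod_instance s _ tight])
    fix v assume v: "v \<in> X"
    have "[net_out E t h s {v} + p' v - q v + of_bool (v = x) = \<tau>' v + of_bool (v = x)] (mod 2 * k)"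
      by (rule cong_add[OF c[OF v] cong_refl])
    then show "[net_out E t h s {v} + p v - q v = \<tau> v] (mod 2 * k)"
      by (cases "v = x") (auto simp: p'_def \<tau>'_def algebra_simps)
  qed
qed

text \<open>Splitting off: the path \<open>y\<close>, \<open>x\<close>, \<open>w\<close> formed by
  \<open>e1\<close> and \<open>e2\<close> becomes one edge from \<open>y\<close> to
  \<open>w\<close>, which takes over the name \<open>e1\<close>. Cut degrees drop, by 2, exactly for
  sets separating \<open>x\<close> from both \<open>y\<close> and \<open>w\<close>. Among singletons
  these are \<open>{x}\<close> and, if the new edge is a loop, \<open>{y}\<close>; hence the
  assumptions \<open>ex\<close> and \<open>ey\<close>.\<close>

lemma lift_edges:
  fixes k :: int and E :: "'e set"
  assumes mod_instance: "mod_instance k X E t h p q \<tau> Z"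
    and e1: "e1 \<in> E" "joins t h e1 y x" and e2: "e2 \<in> E" "joins t h e2 x w" and ne: "e1 \<noteq> e2"
    and slack: "\<And>A. A \<subset> X \<Longrightarrow> card A \<ge> 2 \<Longrightarrow> 2 * k + circ_norm k (sum \<tau> A) \<le> cut_degree E t h p q A"
    and ex: "Z = {x} \<or> 2 * k + circ_norm k (\<tau> x) \<le> cut_degree E t h p q {x}"
    and ey: "y = w \<longrightarrow> 2 * k + circ_norm k (\<tau> y) \<le> cut_degree E t h p q {y}"
    and new: "\<And>(E' :: 'e set) t' h'. mod_instance k X E' t' h' p q \<tau> Z \<Longrightarrow> card E' < card E \<Longrightarrow>
        solvable k X E' t' h' p q \<tau>"
  shows "solvable k X E t h p q \<tau>"
proof -
  note fin = mod_instance_finite[OF mod_instance] and k = mod_instance_k[OF mod_instance]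
  have xy: "x \<noteq> y" "x \<noteq> w" and X: "x \<in> X" "y \<in> X" "w \<in> X"
    using e1 e2 mod_instance_ends[OF mod_instance, of e1] mod_instance_ends[OF mod_instance, of e2] by (auto simp: joins_def)
  define E' where "E' = E - {e2}"
  define t' where "t' = t(e1 := y)"
  define h' where "h' = h(e1 := w)"
  have fE': "finite E'" "e1 \<in> E'" using fin e1 ne by (auto simp: E'_def)
  have f2: "(\<Sum>e\<in>E. g e) = g e2 + (g e1 + (\<Sum>e\<in>E' - {e1}. g e))" for g :: "_ \<Rightarrow> int"
    unfolding sum.remove[OF fin(2) e2(1), of g] using sum.remove[OF fE', of g] by (simp add: E'_def)
  have f1: "(\<Sum>e\<in>E'. g e) = g e1 + (\<Sum>e\<in>E' - {e1}. g e)" for g :: "_ \<Rightarrow> int"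
    using sum.remove[OF fE'] .
  have c': "cut_size E' t' h' A = cut_size E t h A - of_bool ((y \<in> A) \<noteq> (x \<in> A)) - of_bool ((x \<in> A) \<noteq> (w \<in> A))
      + of_bool ((y \<in> A) \<noteq> (w \<in> A))" for A
  proof -
    have "(\<Sum>e\<in>E' - {e1}. of_bool ((t' e \<in> A) \<noteq> (h' e \<in> A)) :: int) = (\<Sum>e\<in>E' - {e1}. of_bool ((t e \<in> A) \<noteq> (h e \<in> A)))"
      by (rule sum.cong) (auto simp: t'_def h'_def)
    moreover have "(t e1 \<in> A) \<noteq> (h e1 \<in> A) \<longleftrightarrow> (y \<in> A) \<noteq> (x \<in> A)"
      "(t e2 \<in> A) \<noteq> (h e2 \<in> A) \<longleftrightarrow> (x \<in> A) \<noteq> (w \<in> A)" using e1 e2 by (auto simp: joins_def)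
    ultimately show ?thesis unfolding cut_size_def f1 f2 by (simp add: t'_def h'_def)
  qed
  have v': "cut_degree E' t' h' p q A = cut_degree E t h p q A - 2 * of_bool ((x \<in> A) \<noteq> (y \<in> A) \<and> (x \<in> A) \<noteq> (w \<in> A))" for A
    unfolding cut_degree_def c' by (cases "x \<in> A"; cases "y \<in> A"; cases "w \<in> A") auto
  have i': "mod_instance k X E' t' h' p q \<tau> Z"
  proof (rule mod_instanceI)
    show "finite X" "finite E'" "k \<ge> 1" using fin k fE' by auto
    show "t' e \<in> X \<and> h' e \<in> X" if "e \<in> E'" for e
      using that mod_instance_ends[OF mod_instance, of e] X by (auto simp: E'_def t'_def h'_def)
    show "0 \<le> p v \<and> 0 \<le> q v" if "v \<in> X" for v using mod_instance_nonneg[OF mod_instance that] .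
    show "even (sum \<tau> A) \<longleftrightarrow> even (cut_degree E' t' h' p q A)" if "A \<subseteq> X" for A
      using mod_instance_parity[OF mod_instance that] by (simp add: v')
    show "[sum \<tau> X = sum p X - sum q X] (mod 2 * k)" using mod_instance_total[OF mod_instance] .
    show "sum p X + sum q X \<le> 2 * k - 2 + circ_norm k (sum \<tau> X)" using mod_instance_le[OF mod_instance] .
    show "Z = {} \<or> (\<exists>x\<in>X. Z = {x} \<and> circ_norm k (\<tau> x) = 0)" using mod_instance_exempt[OF mod_instance] .
    fix A assume A: "A \<noteq> {}" "A \<subset> X" "A \<noteq> Z"
    then have fA: "finite A" using finite_subset fin(1) by blast
    note ge = mod_instance_ge[OF mod_instance A]
    from fA A(1) show "2 * k - 2 + circ_norm k (sum \<tau> A) \<le> cut_degree E' t' h' p q A"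
    proof (cases rule: card_cases)
      case (1 v)
      then show ?thesis using ex ey ge xy A(3) by (cases "v = x"; cases "v = y") (auto simp: v')
    next
      case 2
      show ?thesis using slack[OF A(2) 2] by (simp add: v')
    qed
  qed
  have "card E' < card E" unfolding E'_def by (rule card_Diff1_less[OF fin(2) e2(1)])
  with i' have "solvable k X E' t' h' p q \<tau>" by (rule new)
  then obtain s where s: "\<forall>e. s e = 1 \<or> s e = (- 1 :: int)"
    and c: "\<And>v. v \<in> X \<Longrightarrow> [net_out E' t' h' s {v} + p v - q v = \<tau> v] (mod 2 * k)"
    and b: "\<And>v. v \<in> X \<Longrightarrow> \<bar>net_out E' t' h' s {v} + p v - q v\<bar> \<le> 2 * k - 1"
    unfolding solvable_def by blast
  \<comment> \<open>The direction of the new edge is given to the whole path, which then passes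
    through \<open>x\<close> without changing its net out-degree.\<close>
  define s' where "s' = s(e1 := s e1 * dir_sign t e1 y, e2 := s e1 * dir_sign t e2 x)"
  have n: "net_out E t h s' A = net_out E' t' h' s A" for A
  proof -
    have "(\<Sum>e\<in>E' - {e1}. s' e * (of_bool (t e \<in> A) - of_bool (h e \<in> A)))
        = (\<Sum>e\<in>E' - {e1}. s e * (of_bool (t' e \<in> A) - of_bool (h' e \<in> A)))"
      by (rule sum.cong) (auto simp: s'_def t'_def h'_def E'_def)
    moreover have "s' e1 * (of_bool (t e1 \<in> A) - of_bool (h e1 \<in> A)) = s e1 * (of_bool (y \<in> A) - of_bool (x \<in> A))"
      using ne by (simp add: s'_def mult.assoc dir_sign_mult[OF e1(2)])
    moreover have "s' e2 * (of_bool (t e2 \<in> A) - of_bool (h e2 \<in> A)) = s e1 * (of_bool (x \<in> A) - of_bool (w \<in> A))"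
      by (simp add: s'_def mult.assoc dir_sign_mult[OF e2(2)])
    ultimately show ?thesis unfolding net_out_def f1 f2 by (simp add: t'_def h'_def algebra_simps)
  qed
  show ?thesis
  proof (rule solvableI)
    show "\<forall>e. s' e = 1 \<or> s' e = - 1" using s spec[OF s, of e1] dir_sign_cases[of t e1 y] dir_sign_cases[of t e2 x] by (auto simp: s'_def)
    show "[net_out E t h s' {v} + p v - q v = \<tau> v] (mod 2 * k)" if "v \<in> X" for v
      unfolding n by (rule c[OF that])
    show "\<bar>net_out E t h s' {v} + p v - q v\<bar> \<le> 2 * k - 1" if "v \<in> X" for v
      unfolding n by (rule b[OF that])
  qed
qed

text \<open>Splitting off an edge together with a fixed outgoing half-edge at \<open>x\<close>: the
  edge is directed into \<open>x\<close> and the half-edge moves to \<open>y\<close>. Cut degrees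
  drop, by 2, exactly for sets containing \<open>x\<close> but not \<open>y\<close>, and the number
  of fixed half-edges stays the same.\<close>

lemma lift_stub:
  fixes k :: int
  assumes mod_instance: "mod_instance k X E t h p q \<tau> Z"
    and e: "e \<in> E" "joins t h e y x" and px: "p x > 0"
    and slack: "\<And>A. A \<subset> X \<Longrightarrow> card A \<ge> 2 \<Longrightarrow> 2 * k + circ_norm k (sum \<tau> A) \<le> cut_degree E t h p q A"
    and ex: "Z = {x} \<or> 2 * k + circ_norm k (\<tau> x) \<le> cut_degree E t h p q {x}"
    and new: "\<And>p'. mod_instance k X (E - {e}) t h p' q \<tau> Z \<Longrightarrow> sum p' X = sum p X \<Longrightarrow>
        solvable k X (E - {e}) t h p' q \<tau>"
  shows "solvable k X E t h p q \<tau>"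
proof -
  note fin = mod_instance_finite[OF mod_instance] and k = mod_instance_k[OF mod_instance]
  have xy: "x \<noteq> y" and X: "x \<in> X" "y \<in> X"
    using e mod_instance_ends[OF mod_instance, of e] by (auto simp: joins_def)
  define \<pi> where "\<pi> = p(x := p x  - 1)"
  define p' where "p' = \<pi>(y := \<pi> y + 1)"
  have sp: "sum p' A = sum p A - of_bool (x \<in> A) + of_bool (y \<in> A)" if "finite A" for A
    using that by (simp add: p'_def \<pi>_def sum_upd sum_upd_diff del: fun_upd_apply)
  have v': "cut_degree (E - {e}) t h p' q A = cut_degree E t h p q A - 2 * of_bool (x \<in> A \<and> y \<notin> A)" if "finite A" for A
    using that unfolding cut_degree_def cut_size_delete[OF fin(2) e] sp[OF that]
    by (cases "x \<in> A"; cases "y \<in> A") auto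
  have i': "mod_instance k X (E - {e}) t h p' q \<tau> Z"
  proof (rule mod_instanceI)
    show "finite X" "finite (E - {e})" "k \<ge> 1" using fin k by auto
    show "t e' \<in> X \<and> h e' \<in> X" if "e' \<in> E - {e}" for e'
      using that mod_instance_ends[OF mod_instance, of e'] by blast
    show "0 \<le> p' v \<and> 0 \<le> q v" if "v \<in> X" for v
      using mod_instance_nonneg[OF mod_instance that] px by (auto simp: p'_def \<pi>_def)
    show "even (sum \<tau> A) \<longleftrightarrow> even (cut_degree (E - {e}) t h p' q A)" if "A \<subseteq> X" for A
      using finite_subset[OF that fin(1)] mod_instance_parity[OF mod_instance that] by (simp add: v')
    show "[sum \<tau> X = sum p' X - sum q X] (mod 2 * k)"
      using mod_instance_total[OF mod_instance] fin X by (simp add: sp)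
    show "sum p' X + sum q X \<le> 2 * k - 2 + circ_norm k (sum \<tau> X)"
      using mod_instance_le[OF mod_instance] fin X by (simp add: sp)
    show "Z = {} \<or> (\<exists>x\<in>X. Z = {x} \<and> circ_norm k (\<tau> x) = 0)" using mod_instance_exempt[OF mod_instance] .
    fix A assume A: "A \<noteq> {}" "A \<subset> X" "A \<noteq> Z"
    then have fA: "finite A" using finite_subset fin(1) by blast
    note ge = mod_instance_ge[OF mod_instance A]
    from fA A(1) show "2 * k - 2 + circ_norm k (sum \<tau> A) \<le> cut_degree (E - {e}) t h p' q A"
    proof (cases rule: card_cases)
      case (1 v)
      then show ?thesis using ex ge xy A(3) by (cases "v = x") (auto simp: v')
    next
      case 2
      show ?thesis using slack[OF A(2) 2] by (simp add: v' fA)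
    qed
  qed
  then have "solvable k X (E - {e}) t h p' q \<tau>" by (rule new) (use fin X in \<open>simp add: sp\<close>)
  then obtain s where s: "\<forall>e. s e = 1 \<or> s e = (- 1 :: int)"
    and c: "\<And>v. v \<in> X \<Longrightarrow> [net_out (E - {e}) t h s {v} + p' v - q v = \<tau> v] (mod 2 * k)"
    and b: "\<And>v. v \<in> X \<Longrightarrow> \<bar>net_out (E - {e}) t h s {v} + p' v - q v\<bar> \<le> 2 * k - 1"
    unfolding solvable_def by blast
  have n: "net_out E t h (s(e := dir_sign t e y)) {v} + p v - q v = net_out (E - {e}) t h s {v} + p' v - q v" for v
    using xy unfolding net_out_delete[OF fin(2) e] by (auto simp: p'_def \<pi>_def)
  show ?thesis
  proof (rule solvableI)
    show "\<forall>e'. (s(e := dir_sign t e y)) e' = 1 \<or> (s(e := dir_sign t e y)) e' = - 1"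
      using s dir_sign_cases[of t e y] by simp
    show "[net_out E t h (s(e := dir_sign t e y)) {v} + p v - q v = \<tau> v] (mod 2 * k)" if "v \<in> X" for v
      unfolding n by (rule c[OF that])
    show "\<bar>net_out E t h (s(e := dir_sign t e y)) {v} + p v - q v\<bar> \<le> 2 * k - 1" if "v \<in> X" for v
      unfolding n by (rule b[OF that])
  qed
qed

lemma cut_degree_commute: "cut_degree E t h q p A = cut_degree E t h p q A"
  by (simp add: cut_degree_def)

lemma lift_stub_in:
  fixes k :: int
  assumes mod_instance: "mod_instance k X E t h p q \<tau> Z"
    and e: "e \<in> E" "joins t h e y x" and qx: "q x > 0"
    and slack: "\<And>A. A \<subset> X \<Longrightarrow> card A \<ge> 2 \<Longrightarrow> 2 * k + circ_norm k (sum \<tau> A) \<le> cut_degree E t h p q A"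
    and ex: "Z = {x} \<or> 2 * k + circ_norm k (\<tau> x) \<le> cut_degree E t h p q {x}"
    and new: "\<And>q'. mod_instance k X (E - {e}) t h p q' \<tau> Z \<Longrightarrow> sum q' X = sum q X \<Longrightarrow>
        solvable k X (E - {e}) t h p q' \<tau>"
  shows "solvable k X E t h p q \<tau>"
proof (rule solvable_reverse, rule lift_stub[where p = q and q = p and x = x and y = y and e = e and Z = Z])
  show "mod_instance k X E t h q p (\<lambda>v. - \<tau> v) Z" by (rule mod_instance_reverse[OF mod_instance])
  show "2 * k + circ_norm k (\<Sum>v\<in>A. - \<tau> v) \<le> cut_degree E t h q p A" if "A \<subset> X" "card A \<ge> 2" for A
    using slack[OF that] by (simp add: sum_negf cut_degree_commute)
  show "Z = {x} \<or> 2 * k + circ_norm k (- \<tau> x) \<le> cut_degree E t h q p {x}" using ex by (simp add: cut_degree_commute)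
  fix q' assume q': "mod_instance k X (E - {e}) t h q' p (\<lambda>v. - \<tau> v) Z" "sum q' X = sum q X"
  have "mod_instance k X (E - {e}) t h p q' \<tau> Z" using mod_instance_reverse[OF q'(1)] by simp
  then have "solvable k X (E - {e}) t h p q' \<tau>" using q'(2) by (rule new)
  then show "solvable k X (E - {e}) t h q' p (\<lambda>v. - \<tau> v)"
    by - (rule solvable_reverse, simp)
qed (rule e qx)+

section \<open>Contraction of tight sets\<close>

text \<open>First \<open>A\<close> is shrunk to one vertex and the smaller instance is solved. This
  directs all edges leaving \<open>A\<close>, which then serve as fixed half-edges of an instance on
  \<open>A\<close>. Tightness of \<open>A\<close> says that they are few enough, and the solution at
  the contracted vertex gives the total congruence on \<open>A\<close>.\<close>

lemma contract_tight_set: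
  fixes k :: int and X :: "'v set" and E :: "'e set"
  assumes mod_instance: "mod_instance k X E t h p q \<tau> Z"
    and A: "A \<subset> X" "card A \<ge> 2" "cut_degree E t h p q A \<le> 2 * k - 2 + circ_norm k (sum \<tau> A)"
    and IH: "\<And>(X' :: 'v set) (E' :: 'e set) t' h' p' q' \<tau>' Z'. card X' < card X \<Longrightarrow> mod_instance k X' E' t' h' p' q' \<tau>' Z' \<Longrightarrow>
        solvable k X' E' t' h' p' q' \<tau>'"
  shows "solvable k X E t h p q \<tau>"
proof -
  note fin = mod_instance_finite[OF mod_instance] and k = mod_instance_k[OF mod_instance]
  have fA: "finite A" using A(1) fin(1) finite_subset by blast
  obtain a where a: "a \<in> A" using A(2) by fastforce
  have aX: "a \<in> X" using a A by blast
  define c where "c v = (if v \<in> A then a else v)" for v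
  define X1 where "X1 = insert a (X - A)"
  define p1 where "p1 v = (if v = a then sum p A else p v)" for v
  define q1 where "q1 v = (if v = a then sum q A else q v)" for v
  define \<tau>1 where "\<tau>1 v = (if v = a then sum \<tau> A else \<tau> v)" for v
  \<comment> \<open>An exempt vertex inside \<open>A\<close> disappears in the contraction: as
    \<open>A\<close> has at least two vertices, no set of the contracted instance corresponds to
    \<open>Z\<close>.\<close>
  define Z1 where "Z1 = (if Z \<subseteq> A then {} else Z)"
  \<comment> \<open>\<open>up B\<close> is the preimage of \<open>B\<close> under the contraction
    map \<open>c\<close>. Degrees, targets and cuts of \<open>B\<close> are those of
    \<open>up B\<close>.\<close>
  define up where "up B = (if a \<in> B then B \<union> A else B)" for B
  have Z: "Z = {} \<or> (\<exists>x\<in>X. Z = {x} \<and> circ_norm k (\<tau> x) = 0)" by (rule mod_instance_exempt[OF mod_instance])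
  have cardX1: "card X1 < card X"
  proof -
    have "card X = card (X - A) + card A"
      using A(1) fin(1) by (metis card_Diff_subset card_mono fA le_add_diff_inverse2 psubset_imp_subset)
    moreover have "card X1 = Suc (card (X - A))" using a fin by (simp add: X1_def)
    ultimately show ?thesis using A(2) by simp
  qed
  have up_sum: "(\<Sum>v\<in>B. if v = a then sum f A else f v) = sum f (up B)" if "B \<subseteq> X1" for B and f :: "'v \<Rightarrow> int"
  proof (cases "a \<in> B")
    case True
    have fB: "finite B" using that fin finite_subset by (auto simp: X1_def)
    have eq: "up B = A \<union> (B - {a})" using True a by (auto simp: up_def)
    have "A \<inter> (B - {a}) = {}" using that by (auto simp: X1_def)
    then have "sum f (up B) = sum f A + sum f (B - {a})" using fA fB by (simp add: eq sum.union_disjoint)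
    also have "sum f (B - {a}) = (\<Sum>v\<in>B - {a}. if v = a then sum f A else f v)" by (rule sum.cong) auto
    finally show ?thesis using sum.remove[OF fB True, of "\<lambda>v. if v = a then sum f A else f v"] by simp
  next
    case False
    then show ?thesis unfolding up_def by (auto intro: sum.cong)
  qed
  have up_mem: "c v \<in> B \<longleftrightarrow> v \<in> up B" if "B \<subseteq> X1" for B v
    using that a by (auto simp: c_def up_def X1_def)
  have up_cut: "cut_size E (c \<circ> t) (c \<circ> h) B = cut_size E t h (up B)" if "B \<subseteq> X1" for B
    unfolding cut_size_def by (rule sum.cong) (auto simp: up_mem[OF that])
  have up_val: "cut_degree E (c \<circ> t) (c \<circ> h) p1 q1 B = cut_degree E t h p q (up B)" if "B \<subseteq> X1" for B
    unfolding cut_degree_def p1_def q1_def up_cut[OF that] up_sum[OF that] ..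
  have up_tau: "sum \<tau>1 B = sum \<tau> (up B)" if "B \<subseteq> X1" for B
    unfolding \<tau>1_def by (rule up_sum[OF that])
  have up_sub: "up B \<subseteq> X" if "B \<subseteq> X1" for B using that A(1) aX by (auto simp: up_def X1_def)
  have upX: "up X1 = X" using A(1) a by (auto simp: up_def X1_def)
  have "mod_instance k X1 E (c \<circ> t) (c \<circ> h) p1 q1 \<tau>1 Z1"
  proof (rule mod_instanceI)
    show "finite X1" "finite E" "k \<ge> 1" using fin k by (auto simp: X1_def)
    show "(c \<circ> t) e \<in> X1 \<and> (c \<circ> h) e \<in> X1" if "e \<in> E" for e
      using mod_instance_ends[OF mod_instance that] by (auto simp: X1_def c_def)
    show "0 \<le> p1 x \<and> 0 \<le> q1 x" if "x \<in> X1" for x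
    proof (cases "x = a")
      case True
      then show ?thesis using mod_instance_nonneg[OF mod_instance] A(1) by (auto simp: p1_def q1_def intro!: sum_nonneg)
    next
      case False
      then show ?thesis using that mod_instance_nonneg[OF mod_instance] by (auto simp: p1_def q1_def X1_def)
    qed
    show "even (sum \<tau>1 B) \<longleftrightarrow> even (cut_degree E (c \<circ> t) (c \<circ> h) p1 q1 B)" if "B \<subseteq> X1" for B
      using mod_instance_parity[OF mod_instance up_sub[OF that]] by (simp add: up_val[OF that] up_tau[OF that])
    have sX: "sum p1 X1 = sum p X" "sum q1 X1 = sum q X" "sum \<tau>1 X1 = sum \<tau> X"
      unfolding p1_def q1_def \<tau>1_def by (simp_all add: up_sum upX)
    show "[sum \<tau>1 X1 = sum p1 X1 - sum q1 X1] (mod 2 * k)" using mod_instance_total[OF mod_instance] by (simp add: sX)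
    show "sum p1 X1 + sum q1 X1 \<le> 2 * k - 2 + circ_norm k (sum \<tau>1 X1)" using mod_instance_le[OF mod_instance] by (simp add: sX)
    show "2 * k - 2 + circ_norm k (sum \<tau>1 B) \<le> cut_degree E (c \<circ> t) (c \<circ> h) p1 q1 B"
      if B: "B \<noteq> {}" "B \<subset> X1" "B \<noteq> Z1" for B
    proof -
      have sub: "B \<subseteq> X1" using B by blast
      have "up B \<noteq> {}" using B by (auto simp: up_def)
      moreover have "up B \<subset> X"
      proof -
        obtain x where "x \<in> X1" "x \<notin> B" using B by blast
        then have "x \<in> X" "x \<notin> up B" using aX sub by (auto simp: X1_def up_def)
        then show ?thesis using up_sub[OF sub] by blast
      qed
      moreover have "up B \<noteq> Z"
      proof
        assume eq: "up B = Z"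
        show False
        proof (cases "a \<in> B")
          case True
          then have "A \<subseteq> Z" using eq by (auto simp: up_def)
          then have "card A \<le> 1" using Z card_mono[of Z A] by auto
          then show False using A(2) by simp
        next
          case False
          then have "B = Z" "B \<inter> A = {}" using eq sub by (auto simp: up_def X1_def)
          then show False using B by (cases "Z \<subseteq> A") (simp_all add: Z1_def, blast)
        qed
      qed
      ultimately show ?thesis using mod_instance_ge[OF mod_instance] by (simp add: up_val[OF sub] up_tau[OF sub])
    qed
    show "Z1 = {} \<or> (\<exists>x\<in>X1. Z1 = {x} \<and> circ_norm k (\<tau>1 x) = 0)"
      using Z a by (auto simp: Z1_def X1_def \<tau>1_def)
  qed
  from IH[OF cardX1 this] obtain s1 where s1: "\<forall>e. s1 e = 1 \<or> s1 e = (- 1 :: int)"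
    and c1: "\<And>v. v \<in> X1 \<Longrightarrow> [net_out E (c \<circ> t) (c \<circ> h) s1 {v} + p1 v - q1 v = \<tau>1 v] (mod 2 * k)"
    and b1: "\<And>v. v \<in> X1 \<Longrightarrow> \<bar>net_out E (c \<circ> t) (c \<circ> h) s1 {v} + p1 v - q1 v\<bar> \<le> 2 * k - 1"
    unfolding solvable_def by blast

  \<comment> \<open>The second instance lives on \<open>A\<close>. The functions \<open>out\<close>
    and \<open>inn\<close> count the edges at \<open>v\<close> that leave \<open>A\<close>,
    according to their direction in \<open>s1\<close>.\<close>
  define E2 where "E2 = {e \<in> E. t e \<in> A \<and> h e \<in> A}"
  define out :: "'v \<Rightarrow> int" where "out v = (\<Sum>e\<in>E. of_bool (t e = v \<and> (h e \<notin> A \<and> s1 e = 1)) + of_bool (h e = v \<and> (t e \<notin> A \<and> s1 e = - 1)))"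
    for v
  define inn :: "'v \<Rightarrow> int" where "inn v = (\<Sum>e\<in>E. of_bool (t e = v \<and> (h e \<notin> A \<and> s1 e = - 1)) + of_bool (h e = v \<and> (t e \<notin> A \<and> s1 e = 1)))"
    for v
  define p2 where "p2 v = p v + out v" for v
  define q2 where "q2 v = q v + inn v" for v
  define Z2 where "Z2 = (if Z \<subseteq> A then Z else {})"
  have fin2: "finite E2" using fin by (simp add: E2_def)
  have E2sum: "(\<Sum>e\<in>E2. g e) = (\<Sum>e\<in>E. if t e \<in> A \<and> h e \<in> A then g e else 0)" for g :: "'e \<Rightarrow> int"
    unfolding E2_def using fin by (simp add: sum.inter_filter)
  have out_sum: "sum out B = (\<Sum>e\<in>E. of_bool (t e \<in> B \<and> (h e \<notin> A \<and> s1 e = 1)) + of_bool (h e \<in> B \<and> (t e \<notin> A \<and> s1 e = - 1)))"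
    and inn_sum: "sum inn B = (\<Sum>e\<in>E. of_bool (t e \<in> B \<and> (h e \<notin> A \<and> s1 e = - 1)) + of_bool (h e \<in> B \<and> (t e \<notin> A \<and> s1 e = 1)))"
    if "B \<subseteq> A" for B
    unfolding out_def inn_def using finite_subset[OF that fA]
    by (subst sum.swap, simp only: sum.distrib sum_of_bool_eq)+
  have val2: "cut_degree E2 t h p2 q2 B = cut_degree E t h p q B" if "B \<subseteq> A" for B
  proof -
    have "cut_size E2 t h B + sum out B + sum inn B = cut_size E t h B"
      unfolding cut_size_def E2sum out_sum[OF that] inn_sum[OF that] sum.distrib[symmetric]
    proof (rule sum.cong[OF refl])
      fix e assume "e \<in> E"
      show "(if t e \<in> A \<and> h e \<in> A then of_bool ((t e \<in> B) \<noteq> (h e \<in> B)) else 0) +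
         (of_bool (t e \<in> B \<and> (h e \<notin> A \<and> s1 e = 1)) + of_bool (h e \<in> B \<and> (t e \<notin> A \<and> s1 e = - 1))) +
         (of_bool (t e \<in> B \<and> (h e \<notin> A \<and> s1 e = - 1)) + of_bool (h e \<in> B \<and> (t e \<notin> A \<and> s1 e = 1)))
         = (of_bool ((t e \<in> B) \<noteq> (h e \<in> B)) :: int)"
        using that spec[OF s1, of e] by auto
    qed
    then show ?thesis unfolding cut_degree_def p2_def q2_def by (simp add: sum.distrib)
  qed
  have out_eq: "out v - inn v = (\<Sum>e\<in>E. s1 e * (of_bool (t e = v \<and> h e \<notin> A) - of_bool (h e = v \<and> t e \<notin> A)))" for v
    unfolding out_def inn_def sum_subtractf[symmetric]
  proof (rule sum.cong[OF refl])
    fix e assume "e \<in> E"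
    show "of_bool (t e = v \<and> (h e \<notin> A \<and> s1 e = 1)) + of_bool (h e = v \<and> (t e \<notin> A \<and> s1 e = - 1)) -
         (of_bool (t e = v \<and> (h e \<notin> A \<and> s1 e = - 1)) + of_bool (h e = v \<and> (t e \<notin> A \<and> s1 e = 1)))
        = s1 e * (of_bool (t e = v \<and> h e \<notin> A) - of_bool (h e = v \<and> t e \<notin> A))"
      using spec[OF s1, of e] by auto
  qed
  have outA_eq: "sum out A - sum inn A = net_out E (c \<circ> t) (c \<circ> h) s1 {a}"
    unfolding net_out_def out_sum[OF subset_refl] inn_sum[OF subset_refl] sum_subtractf[symmetric]
  proof (rule sum.cong[OF refl])
    fix e assume "e \<in> E"
    have "c v \<in> {a} \<longleftrightarrow> v \<in> A" for v using a by (auto simp: c_def)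
    then show "of_bool (t e \<in> A \<and> (h e \<notin> A \<and> s1 e = 1)) + of_bool (h e \<in> A \<and> (t e \<notin> A \<and> s1 e = - 1)) -
         (of_bool (t e \<in> A \<and> (h e \<notin> A \<and> s1 e = - 1)) + of_bool (h e \<in> A \<and> (t e \<notin> A \<and> s1 e = 1)))
        = s1 e * (of_bool ((c \<circ> t) e \<in> {a}) - of_bool ((c \<circ> h) e \<in> {a}))"
      using spec[OF s1, of e] by auto
  qed
  have "mod_instance k A E2 t h p2 q2 \<tau> Z2"
  proof (rule mod_instanceI)
    show "finite A" "finite E2" "k \<ge> 1" using fA fin2 k by auto
    show "t e \<in> A \<and> h e \<in> A" if "e \<in> E2" for e using that by (simp add: E2_def)
    show "0 \<le> p2 x \<and> 0 \<le> q2 x" if "x \<in> A" for x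
      using that mod_instance_nonneg[OF mod_instance, of x] A(1) unfolding p2_def q2_def out_def inn_def
      by (auto intro!: add_nonneg_nonneg sum_nonneg)
    show "even (sum \<tau> B) \<longleftrightarrow> even (cut_degree E2 t h p2 q2 B)" if "B \<subseteq> A" for B
      using mod_instance_parity[OF mod_instance, of B] that A(1) val2[OF that] by auto
    show "[sum \<tau> A = sum p2 A - sum q2 A] (mod 2 * k)"
    proof -
      have "sum p2 A - sum q2 A = net_out E (c \<circ> t) (c \<circ> h) s1 {a} + p1 a - q1 a"
        using outA_eq by (simp add: p2_def q2_def sum.distrib p1_def q1_def)
      then show ?thesis using c1[of a] by (simp add: X1_def \<tau>1_def cong_sym)
    qed
    \<comment> \<open>No edge inside \<open>A\<close> crosses \<open>A\<close>, so the fixed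
      half-edges number exactly the cut degree of \<open>A\<close>; here tightness enters.\<close>
    show "sum p2 A + sum q2 A \<le> 2 * k - 2 + circ_norm k (sum \<tau> A)"
    proof -
      have "cut_size E2 t h A = 0" unfolding cut_size_def E2_def by (rule sum.neutral) auto
      then have "sum p2 A + sum q2 A = cut_degree E t h p q A" using val2[of A] by (simp add: cut_degree_def)
      then show ?thesis using A(3) by simp
    qed
    show "2 * k - 2 + circ_norm k (sum \<tau> B) \<le> cut_degree E2 t h p2 q2 B" if B: "B \<noteq> {}" "B \<subset> A" "B \<noteq> Z2" for B
    proof -
      have "B \<noteq> Z" using B by (auto simp: Z2_def)
      then show ?thesis using mod_instance_ge[OF mod_instance, of B] val2[of B] B A(1) by auto
    qed
    show "Z2 = {} \<or> (\<exists>x\<in>A. Z2 = {x} \<and> circ_norm k (\<tau> x) = 0)" using Z by (auto simp: Z2_def)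
  qed
  from IH[OF psubset_card_mono[OF fin(1) A(1)] this]
  obtain s2 where s2: "\<forall>e. s2 e = 1 \<or> s2 e = (- 1 :: int)"
    and c2: "\<And>v. v \<in> A \<Longrightarrow> [net_out E2 t h s2 {v} + p2 v - q2 v = \<tau> v] (mod 2 * k)"
    and b2: "\<And>v. v \<in> A \<Longrightarrow> \<bar>net_out E2 t h s2 {v} + p2 v - q2 v\<bar> \<le> 2 * k - 1"
    unfolding solvable_def by blast
  \<comment> \<open>Edges within \<open>A\<close> follow the second solution and all others the
    first. The two agree on the edges leaving \<open>A\<close> by the choice of \<open>p2\<close>
    and \<open>q2\<close>.\<close>
  define s where "s e = (if t e \<in> A \<and> h e \<in> A then s2 e else s1 e)" for e
  have in_A: "net_out E t h s {v} + p v - q v = net_out E2 t h s2 {v} + p2 v - q2 v" if "v \<in> A" for v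
  proof -
    have "net_out E t h s {v} = net_out E2 t h s2 {v} + (out v - inn v)"
      unfolding net_out_def E2sum out_eq sum.distrib[symmetric]
      by (rule sum.cong[OF refl]) (use that in \<open>auto simp: s_def\<close>)
    then show ?thesis by (simp add: p2_def q2_def)
  qed
  have out_A: "net_out E t h s {v} + p v - q v = net_out E (c \<circ> t) (c \<circ> h) s1 {v} + p1 v - q1 v" if "v \<notin> A" for v
  proof -
    have ne: "v \<noteq> a" using that a by blast
    have "net_out E t h s {v} = net_out E (c \<circ> t) (c \<circ> h) s1 {v}"
      unfolding net_out_def
      by (rule sum.cong[OF refl]) (use that ne in \<open>auto simp: s_def c_def\<close>)
    then show ?thesis using ne by (simp add: p1_def q1_def)
  qed
  show ?thesis
  proof (rule solvableI)
    show "\<forall>e. s e = 1 \<or> s e = - 1" using s1 s2 by (simp add: s_def)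
    fix v assume v: "v \<in> X"
    show "[net_out E t h s {v} + p v - q v = \<tau> v] (mod 2 * k)"
    proof (cases "v \<in> A")
      case False
      then have "v \<in> X1" "\<tau>1 v = \<tau> v" using v a by (auto simp: X1_def \<tau>1_def)
      then show ?thesis using c1[of v] by (simp add: out_A[OF False])
    qed (simp add: in_A c2)
    show "\<bar>net_out E t h s {v} + p v - q v\<bar> \<le> 2 * k - 1"
    proof (cases "v \<in> A")
      case False
      then show ?thesis using v b1[of v] by (simp add: out_A[OF False] X1_def)
    qed (use in_A b2 in simp)
  qed
qed

section \<open>Parity slack and the elimination of a vertex with residue 0\<close>

lemma signs_with_sum:
  assumes "finite F" "\<bar>j\<bar> \<le> int (card F)" "even (j - int (card F))"
  obtains \<sigma> where "\<forall>e. \<sigma> e = 1 \<or> \<sigma> e = (- 1 :: int)" "sum \<sigma> F = j"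
proof -
  \<comment> \<open>\<open>m\<close> is the number of positive signs.\<close>
  obtain m where m: "int (card F) + j = 2 * m"
    using assms(3) by (metis dvd_def even_diff add.commute)
  then have "0 \<le> m" "m \<le> int (card F)" using assms(2) by linarith+
  then obtain T where T: "T \<subseteq> F" "int (card T) = m"
    by (metis obtain_subset_with_card_n nat_int nat_mono int_nat_eq)
  define \<sigma> where "\<sigma> e = (if e \<in> T then 1 else - 1 :: int)" for e
  have "sum \<sigma> F = sum \<sigma> (F - T) + sum \<sigma> T" by (rule sum.subset_diff[OF T(1) assms(1)])
  also have "sum \<sigma> (F - T) = - int (card (F - T))" by (simp add: \<sigma>_def)
  also have "sum \<sigma> T = int (card T)" by (simp add: \<sigma>_def)
  also have "int (card (F - T)) = int (card F) - int (card T)"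
    using T(1) assms(1) by (simp add: card_Diff_subset finite_subset card_mono)
  finally have "sum \<sigma> F = j" using m T(2) by simp
  then show ?thesis using that[of \<sigma>] by (simp add: \<sigma>_def)
qed

text \<open>Cut degree and norm of the target have the same parity, so a set that is not tight
  exceeds its bound by at least 2. This is the amount that splitting off consumes.\<close>

lemma mod_instance_slack:
  assumes mod_instance: "mod_instance k X E t h p q \<tau> Z" and A: "A \<noteq> {}" "A \<subset> X" "A \<noteq> Z"
    and gt: "\<not> cut_degree E t h p q A \<le> 2 * k - 2 + circ_norm k (sum \<tau> A)"
  shows "2 * k + circ_norm k (sum \<tau> A) \<le> cut_degree E t h p q A"
proof -
  have "even (cut_degree E t h p q A - circ_norm k (sum \<tau> A))"
    using mod_instance_parity[OF mod_instance, of A] A(2) even_circ_norm_iff[OF mod_instance_k[OF mod_instance], of "sum \<tau> A"] by auto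
  then obtain c where c: "cut_degree E t h p q A - circ_norm k (sum \<tau> A) = 2 * c" by (rule evenE)
  then have "c > k - 1" using gt by linarith
  then show ?thesis using c by linarith
qed

lemma mod_instance_total_circ_norm:
  assumes "mod_instance k X E t h p q \<tau> Z"
  shows "circ_norm k (sum \<tau> X) \<le> sum p X + sum q X"
proof -
  have "circ_norm k (sum \<tau> X) = circ_norm k (sum p X - sum q X)" by (rule circ_norm_cong[OF mod_instance_total[OF assms]])
  also have "\<dots> \<le> \<bar>sum p X - sum q X\<bar>" by (rule circ_norm_le_abs[OF mod_instance_k[OF assms]])
  also have "\<dots> \<le> sum p X + sum q X"
    using mod_instance_nonneg[OF assms] by (auto simp: abs_le_iff intro!: sum_nonneg)
  finally show ?thesis .
qed

text \<open>All edges are loops and contribute nothing, so the fixed half-edges alone decide. Their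
  number is bounded by \<open>mod_instance_le\<close>, and \<open>abs_le_of_circ_norm\<close>
  applies.\<close>

lemma solvable_single:
  assumes mod_instance: "mod_instance k X E t h p q \<tau> Z" and X: "X = {x}"
  shows "solvable k X E t h p q \<tau>"
proof -
  have net_out: "net_out E t h (\<lambda>_. 1) {x} = 0"
    unfolding net_out_def using mod_instance_ends[OF mod_instance] X by (intro sum.neutral) auto
  have c: "[p x - q x = \<tau> x] (mod 2 * k)" using mod_instance_total[OF mod_instance] X by (simp add: cong_sym)
  have "\<bar>p x - q x\<bar> \<le> 2 * k - 2 + circ_norm k (p x - q x)"
    using mod_instance_le[OF mod_instance] mod_instance_nonneg[OF mod_instance, of x] X circ_norm_cong[OF c] by simp linarith
  then have "\<bar>p x - q x\<bar> \<le> 2 * k - 1" by (rule abs_le_of_circ_norm[OF mod_instance_k[OF mod_instance]])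
  then show ?thesis using c X net_out by (intro solvableI[of "\<lambda>_. 1"]) auto
qed

lemma cut_size_separated:
  assumes "B \<subseteq> X" "\<And>e x y. e \<in> E \<Longrightarrow> joins t h e y x \<Longrightarrow> x \<in> B \<Longrightarrow> y \<notin> X - B"
    and "\<And>e. e \<in> E \<Longrightarrow> t e \<in> X \<and> h e \<in> X"
  shows "cut_size E t h B = 0"
  unfolding cut_size_def
proof (rule sum.neutral, rule ballI)
  fix e assume e: "e \<in> E"
  have "\<not> ((t e \<in> B) \<noteq> (h e \<in> B))"
    using assms(2)[OF e, of "t e" "h e"] assms(2)[OF e, of "h e" "t e"] assms(3)[OF e]
    by (cases "t e = h e") (auto simp: joins_def)
  then show "of_bool ((t e \<in> B) \<noteq> (h e \<in> B)) = (0 :: int)" by simp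
qed

text \<open>If no edge leaves \<open>B\<close>, both cut degrees consist of fixed half-edges only.
  As \<open>mod_instance_le\<close> limits the sum, this serves to force edges between
  \<open>B\<close> and its complement.\<close>

lemma mod_instance_separated:
  assumes mod_instance: "mod_instance k X E t h p q \<tau> Z" and B: "B \<noteq> {}" "B \<subset> X"
    and sep: "\<And>e x y. e \<in> E \<Longrightarrow> joins t h e y x \<Longrightarrow> x \<in> B \<Longrightarrow> y \<notin> X - B"
  shows "cut_degree E t h p q B + cut_degree E t h p q (X - B) = sum p X + sum q X"
proof -
  have "cut_size E t h B = 0"
    by (rule cut_size_separated[OF _ sep mod_instance_ends[OF mod_instance]]) (use B in auto)
  moreover have "cut_size E t h (X - B) = 0"
  proof (rule cut_size_separated[OF _ _ mod_instance_ends[OF mod_instance]])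
    fix e x y assume "e \<in> E" "joins t h e y x" "x \<in> X - B"
    then show "y \<notin> X - (X - B)" using sep joins_sym by fast
  qed auto
  moreover have "sum f X = sum f (X - B) + sum f B" for f :: "_ \<Rightarrow> int"
    by (rule sum.subset_diff) (use B mod_instance_finite[OF mod_instance] in auto)
  ultimately show ?thesis by (simp add: cut_degree_def)
qed

text \<open>All non-loop edges at \<open>x\<close> go to \<open>y\<close>, so \<open>x\<close> may
  be merged into \<open>y\<close>: its target vanishes modulo \<open>2 * k\<close>, and it carries
  no fixed half-edges. Afterwards the edges between \<open>x\<close> and \<open>y\<close>, even in
  number, are directed half in each direction.\<close>

lemma remove_vertex:
  fixes k :: int and X :: "'v set" and E :: "'e set"
  assumes mod_instance: "mod_instance k X E t h p q \<tau> {x}" and xy: "x \<in> X" "y \<in> X" "y \<noteq> x"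
    and only: "\<And>e w. e \<in> E \<Longrightarrow> joins t h e w x \<Longrightarrow> w = y" and zero: "p x = 0" "q x = 0"
    and IH: "\<And>(X' :: 'v set) (E' :: 'e set) t' h' p' q' \<tau>' Z'. card X' < card X \<Longrightarrow> mod_instance k X' E' t' h' p' q' \<tau>' Z' \<Longrightarrow>
        solvable k X' E' t' h' p' q' \<tau>'"
  shows "solvable k X E t h p q \<tau>"
proof -
  note fin = mod_instance_finite[OF mod_instance] and k = mod_instance_k[OF mod_instance]
  have t0: "circ_norm k (\<tau> x) = 0" using mod_instance_exempt[OF mod_instance] by simp
  have tx: "[\<tau> x = 0] (mod 2 * k)" using t0 circ_norm_eq_0_iff[OF k] by (simp add: cong_def)
  define X' where "X' = X - {x}"
  define E' where "E' = {e \<in> E. t e \<noteq> x \<and> h e \<noteq> x}"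
  define F where "F = {e \<in> E. joins t h e x y}"
  \<comment> \<open>The vertex \<open>x\<close> follows \<open>y\<close>. A set and its image under
    \<open>up\<close> have equal cut degrees and norms.\<close>
  define up where "up A = (if y \<in> A then insert x A else A)" for A
  have E'sum: "(\<Sum>e\<in>E'. g e) = (\<Sum>e\<in>E. if t e \<noteq> x \<and> h e \<noteq> x then g e else 0)" for g :: "'e \<Rightarrow> int"
    unfolding E'_def using fin by (simp add: sum.inter_filter)
  have Fsum: "(\<Sum>e\<in>F. g e) = (\<Sum>e\<in>E. if joins t h e x y then g e else 0)" for g :: "'e \<Rightarrow> int"
    unfolding F_def using fin by (simp add: sum.inter_filter)
  have at_x: "t e = x \<and> h e = x \<or> joins t h e x y" if "e \<in> E" "\<not> (t e \<noteq> x \<and> h e \<noteq> x)" for e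
    using that only[OF that(1), of "h e"] only[OF that(1), of "t e"] xy(3) by (auto simp: joins_def)
  have up_sum: "sum f (up A) = sum f A + of_bool (y \<in> A) * f x" if "A \<subseteq> X'" for A and f :: "'v \<Rightarrow> int"
  proof -
    have "finite A" "x \<notin> A" using that fin finite_subset[of A X] by (auto simp: X'_def)
    then show ?thesis by (simp add: up_def)
  qed
  have up_nrm: "circ_norm k (sum \<tau> (up A)) = circ_norm k (sum \<tau> A)" if "A \<subseteq> X'" for A
  proof (rule circ_norm_cong)
    have "[sum \<tau> A + of_bool (y \<in> A) * \<tau> x = sum \<tau> A + of_bool (y \<in> A) * 0] (mod 2 * k)"
      by (intro cong_add cong_mult cong_refl tx)
    then show "[sum \<tau> (up A) = sum \<tau> A] (mod 2 * k)" by (simp add: up_sum[OF that])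
  qed
  have up_val: "cut_degree E t h p q (up A) = cut_degree E' t h p q A" if "A \<subseteq> X'" for A
  proof -
    have "cut_size E t h (up A) = cut_size E' t h A"
      unfolding cut_size_def E'sum
    proof (rule sum.cong[OF refl])
      fix e assume "e \<in> E"
      show "of_bool ((t e \<in> up A) \<noteq> (h e \<in> up A)) =
          (if t e \<noteq> x \<and> h e \<noteq> x then of_bool ((t e \<in> A) \<noteq> (h e \<in> A)) else (0 :: int))"
        using at_x[OF \<open>e \<in> E\<close>] that xy(3) by (auto simp: up_def joins_def X'_def)
    qed
    then show ?thesis by (simp add: cut_degree_def up_sum[OF that] zero)
  qed
  have up_sub: "up A \<subseteq> X" if "A \<subseteq> X'" for A using that xy by (auto simp: up_def X'_def)
  have "up X' = X" using xy by (auto simp: up_def X'_def)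
  then have sX: "sum p X' = sum p X" "sum q X' = sum q X" "circ_norm k (sum \<tau> X') = circ_norm k (sum \<tau> X)"
    "[sum \<tau> X' = sum \<tau> X] (mod 2 * k)"
    using up_sum[of X' p] up_sum[of X' q] up_nrm[of X'] up_sum[of X' \<tau>] tx zero xy
      cong_add[OF cong_refl[of "sum \<tau> X'" "2 * k"] tx] by (auto simp: X'_def cong_sym)
  have "mod_instance k X' E' t h p q \<tau> {}"
  proof (rule mod_instanceI)
    show "finite X'" "finite E'" "k \<ge> 1" using fin k by (auto simp: X'_def E'_def)
    show "t e \<in> X' \<and> h e \<in> X'" if "e \<in> E'" for e using that mod_instance_ends[OF mod_instance] by (auto simp: E'_def X'_def)
    show "0 \<le> p v \<and> 0 \<le> q v" if "v \<in> X'" for v using that mod_instance_nonneg[OF mod_instance] by (simp add: X'_def)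
    show "even (sum \<tau> A) \<longleftrightarrow> even (cut_degree E' t h p q A)" if "A \<subseteq> X'" for A
      using mod_instance_parity[OF mod_instance up_sub[OF that]] up_val[OF that] even_circ_norm_iff[OF k] up_nrm[OF that] by metis
    show "[sum \<tau> X' = sum p X' - sum q X'] (mod 2 * k)"
      unfolding sX(1,2) by (rule cong_trans[OF sX(4) mod_instance_total[OF mod_instance]])
    show "sum p X' + sum q X' \<le> 2 * k - 2 + circ_norm k (sum \<tau> X')" using mod_instance_le[OF mod_instance] sX by simp
    show "2 * k - 2 + circ_norm k (sum \<tau> A) \<le> cut_degree E' t h p q A" if A: "A \<noteq> {}" "A \<subset> X'" for A
    proof -
      have sub: "A \<subseteq> X'" using A by blast
      obtain v where v: "v \<in> A" using A by blast
      then have "v \<noteq> x" "up A \<noteq> {}" using sub by (auto simp: X'_def up_def)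
      moreover have "up A \<noteq> {x}" using v \<open>v \<noteq> x\<close> by (auto simp: up_def)
      moreover have "up A \<subset> X"
      proof -
        obtain w where "w \<in> X'" "w \<notin> A" using A by blast
        then have "w \<in> X" "w \<notin> up A" by (auto simp: X'_def up_def)
        then show ?thesis using up_sub[OF sub] by blast
      qed
      ultimately show ?thesis using mod_instance_ge[OF mod_instance] up_val[OF sub] up_nrm[OF sub] by metis
    qed
  qed simp
  moreover have "card X' < card X" unfolding X'_def by (rule card_Diff1_less[OF fin(1) xy(1)])
  ultimately have "solvable k X' E' t h p q \<tau>" using IH by blast
  then obtain s where s: "\<forall>e. s e = 1 \<or> s e = (- 1 :: int)"
    and c: "\<And>v. v \<in> X' \<Longrightarrow> [net_out E' t h s {v} + p v - q v = \<tau> v] (mod 2 * k)"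
    and b: "\<And>v. v \<in> X' \<Longrightarrow> \<bar>net_out E' t h s {v} + p v - q v\<bar> \<le> 2 * k - 1"
    unfolding solvable_def by blast
  have "cut_size E t h {x} = (\<Sum>e\<in>F. 1)"
    unfolding cut_size_def Fsum
  proof (rule sum.cong[OF refl])
    fix e assume "e \<in> E"
    show "of_bool ((t e \<in> {x}) \<noteq> (h e \<in> {x})) = (if joins t h e x y then 1 else (0 :: int))"
      using at_x[OF \<open>e \<in> E\<close>] xy(3) by (auto simp: joins_def)
  qed
  then have "cut_degree E t h p q {x} = int (card F)" by (simp add: cut_degree_def zero)
  moreover have "even (\<tau> x)" using even_circ_norm_iff[OF k, of "\<tau> x"] t0 by simp
  ultimately have "even (int (card F))" using mod_instance_parity[OF mod_instance, of "{x}"] xy by simp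
  \<comment> \<open>Signs of sum 0 make the parallel edges invisible at \<open>y\<close> as well as
    at \<open>x\<close>.\<close>
  then obtain \<sigma> where \<sigma>: "\<forall>e. \<sigma> e = 1 \<or> \<sigma> e = (- 1 :: int)" "sum \<sigma> F = 0"
    using signs_with_sum[of F 0] fin by (auto simp: F_def)
  define s' where "s' e = (if joins t h e x y then \<sigma> e * dir_sign t e x else s e)" for e
  have net_out': "net_out E t h s' {v} = (if v = x then 0 else net_out E' t h s {v})" for v
  proof -
    have "net_out E t h s' {v} = (\<Sum>e\<in>E. if t e \<noteq> x \<and> h e \<noteq> x then s e * (of_bool (t e \<in> {v}) - of_bool (h e \<in> {v})) else 0)
       + (\<Sum>e\<in>F. \<sigma> e * (of_bool (x \<in> {v}) - of_bool (y \<in> {v})))"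
      unfolding net_out_def Fsum sum.distrib[symmetric]
    proof (rule sum.cong[OF refl])
      fix e assume e: "e \<in> E"
      consider "t e \<noteq> x \<and> h e \<noteq> x" | "t e = x \<and> h e = x" | "joins t h e x y" using at_x[OF e] by blast
      then show "s' e * (of_bool (t e \<in> {v}) - of_bool (h e \<in> {v})) =
          (if t e \<noteq> x \<and> h e \<noteq> x then s e * (of_bool (t e \<in> {v}) - of_bool (h e \<in> {v})) else 0) +
          (if joins t h e x y then \<sigma> e * (of_bool (x \<in> {v}) - of_bool (y \<in> {v})) else 0)"
      proof cases
        case 3
        then have "\<not> (t e \<noteq> x \<and> h e \<noteq> x)" by (auto simp: joins_def)
        moreover have "s' e * (of_bool (t e \<in> {v}) - of_bool (h e \<in> {v})) = \<sigma> e * (of_bool (x \<in> {v}) - of_bool (y \<in> {v}))"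
          using 3 dir_sign_mult[OF 3, of "{v}"] by (simp add: s'_def mult.assoc)
        ultimately show ?thesis using 3 by auto
      qed (auto simp: s'_def joins_def)
    qed
    also have "(\<Sum>e\<in>F. \<sigma> e * (of_bool (x \<in> {v}) - of_bool (y \<in> {v}))) = 0"
      by (simp only: sum_distrib_right[symmetric] \<sigma>(2) mult_zero_left)
    also have "(\<Sum>e\<in>E. if t e \<noteq> x \<and> h e \<noteq> x then s e * (of_bool (t e \<in> {v}) - of_bool (h e \<in> {v})) else 0)
        = net_out E' t h s {v}" by (simp only: net_out_def E'sum)
    also have "net_out E' t h s {v} = (if v = x then 0 else net_out E' t h s {v})"
      unfolding net_out_def E'_def by (auto intro!: sum.neutral)
    finally show ?thesis by simp
  qed
  show ?thesis
  proof (rule solvableI)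
    show "\<forall>e. s' e = 1 \<or> s' e = - 1"
      using s \<sigma>(1) dir_sign_cases[of t _ x] by (auto simp: s'_def) (metis mult_minus1_right mult_1_right minus_minus)+
    fix v assume v: "v \<in> X"
    show "[net_out E t h s' {v} + p v - q v = \<tau> v] (mod 2 * k)"
      using v c[of v] tx by (cases "v = x") (auto simp: net_out' zero X'_def cong_sym)
    show "\<bar>net_out E t h s' {v} + p v - q v\<bar> \<le> 2 * k - 1"
      using v b[of v] k by (cases "v = x") (auto simp: net_out' zero X'_def)
  qed
qed

text \<open>Since \<open>{x}\<close> is exempt from the degree condition, splitting off at
  \<open>x\<close> may continue until it is exhausted; each such step lowers the number of edges. It
  stops only when a tight set can be contracted or when \<open>remove_vertex\<close>
  applies.\<close>

lemma exempt_vertex_step: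
  fixes k :: int and X :: "'v set" and E :: "'e set"
  assumes IH: "\<And>(X' :: 'v set) (E' :: 'e set) t' h' p' q' \<tau>' Z'. card X' < card X \<Longrightarrow> mod_instance k X' E' t' h' p' q' \<tau>' Z' \<Longrightarrow>
        solvable k X' E' t' h' p' q' \<tau>'"
    and mod_instance: "mod_instance k X E t h p q \<tau> {x}"
  shows "solvable k X E t h p q \<tau>"
  using mod_instance
proof (induction "card E" arbitrary: E t h p q rule: less_induct)
  case less
  note mod_instance = less.prems
  note fin = mod_instance_finite[OF mod_instance] and k = mod_instance_k[OF mod_instance]
  have x: "x \<in> X" "circ_norm k (\<tau> x) = 0" using mod_instance_exempt[OF mod_instance] by auto
  show ?case
  proof (cases "X = {x}")
    case True
    then show ?thesis by (rule solvable_single[OF mod_instance])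
  next
    case False
    then obtain y0 where y0: "y0 \<in> X" "y0 \<noteq> x" using x by blast
    show ?thesis
    proof (cases "\<exists>A. A \<subset> X \<and> card A \<ge> 2 \<and> cut_degree E t h p q A \<le> 2 * k - 2 + circ_norm k (sum \<tau> A)")
      case True
      then obtain A where A: "A \<subset> X" "card A \<ge> 2" "cut_degree E t h p q A \<le> 2 * k - 2 + circ_norm k (sum \<tau> A)" by blast
      show ?thesis by (rule contract_tight_set[OF mod_instance A]) (rule IH)
    next
      case no_tight: False
      have slack: "2 * k + circ_norm k (sum \<tau> A) \<le> cut_degree E t h p q A" if "A \<subset> X" "card A \<ge> 2" for A
        by (rule mod_instance_slack[OF mod_instance]) (use that no_tight in auto)
      consider (edges) e1 e2 y w where "e1 \<in> E" "e2 \<in> E" "joins t h e1 y x" "joins t h e2 x w" "y \<noteq> w"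
        | (out) e y where "e \<in> E" "joins t h e y x" "p x > 0"
        | (inn) e y where "e \<in> E" "joins t h e y x" "q x > 0"
        | (free) y where "y \<in> X" "y \<noteq> x" "p x = 0" "q x = 0" "\<And>e w. e \<in> E \<Longrightarrow> joins t h e w x \<Longrightarrow> w = y"
      proof (cases "\<exists>e\<in>E. \<exists>y. joins t h e y x")
        case True
        then obtain e y where e: "e \<in> E" "joins t h e y x" by blast
        then have y: "y \<in> X" "y \<noteq> x" using mod_instance_ends[OF mod_instance e(1)] by (auto simp: joins_def)
        show ?thesis
        proof (cases "p x > 0 \<or> q x > 0")
          case True
          then show ?thesis using out inn e by blast
        next
          case False
          then have "p x = 0" "q x = 0" using mod_instance_nonneg[OF mod_instance x(1)] by auto
          then show ?thesis using free[OF y] edges[OF e(1) _ e(2)] joins_sym by metis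
        qed
      next
        case False
        \<comment> \<open>Here \<open>x\<close> has only loops. The complement of \<open>x\<close>
          already uses up the permitted number of fixed half-edges, so \<open>x\<close> has
          none.\<close>
        have "cut_degree E t h p q {x} + cut_degree E t h p q (X - {x}) = sum p X + sum q X"
          by (rule mod_instance_separated[OF mod_instance]) (use False x y0 in auto)
        moreover have "2 * k - 2 + circ_norm k (sum \<tau> (X - {x})) \<le> cut_degree E t h p q (X - {x})"
          by (rule mod_instance_ge[OF mod_instance]) (use x y0 in auto)
        moreover have "circ_norm k (sum \<tau> X) \<le> circ_norm k (\<tau> x) + circ_norm k (sum \<tau> (X - {x}))"
          unfolding sum.remove[OF fin(1) x(1)] by (rule circ_norm_triangle[OF k])
        ultimately have "cut_degree E t h p q {x} \<le> 0" using mod_instance_le[OF mod_instance] x(2) by linarith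
        then have "p x = 0" "q x = 0"
          using mod_instance_nonneg[OF mod_instance x(1)] cut_size_nonneg[of E t h "{x}"] by (auto simp: cut_degree_def)
        then show ?thesis using free[OF y0] False by blast
      qed
      then show ?thesis
      proof cases
        case (edges e1 e2 y w)
        then have "e1 \<noteq> e2" by (auto simp: joins_def)
        show ?thesis
          by (rule lift_edges[OF mod_instance edges(1,3,2,4) \<open>e1 \<noteq> e2\<close> slack]) (use edges less.hyps in auto)
      next
        case (out e y)
        show ?thesis
          by (rule lift_stub[OF mod_instance out slack])
            (use less.hyps card_Diff1_less[OF fin(2) out(1)] in auto)
      next
        case (inn e y)
        show ?thesis
          by (rule lift_stub_in[OF mod_instance inn slack])
            (use less.hyps card_Diff1_less[OF fin(2) inn(1)] in auto)
      next
        case (free y)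
        show ?thesis by (rule remove_vertex[OF mod_instance x(1) free(1,2) free(5) free(3,4) IH])
      qed
    qed
  qed
qed

lemma mod_instance_exempt_vertex:
  assumes mod_instance: "mod_instance k X E t h p q \<tau> {}" and x: "x \<in> X" "circ_norm k (\<tau> x) = 0"
  shows "mod_instance k X E t h p q \<tau> {x}"
proof (rule mod_instanceI)
  show "{x} = {} \<or> (\<exists>y\<in>X. {x} = {y} \<and> circ_norm k (\<tau> y) = 0)" using x by blast
  show "2 * k - 2 + circ_norm k (sum \<tau> A) \<le> cut_degree E t h p q A" if "A \<noteq> {}" "A \<subset> X" for A
    by (rule mod_instance_ge[OF mod_instance that that(1)])
qed (rule mod_instance_finite[OF mod_instance] mod_instance_k[OF mod_instance] mod_instance_ends[OF mod_instance] mod_instance_nonneg[OF mod_instance] mod_instance_parity[OF mod_instance]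
  mod_instance_total[OF mod_instance] mod_instance_le[OF mod_instance]; assumption?)+

section \<open>The last cases and the induction\<close>

text \<open>With all residues in \<open>(0, k)\<close>, lowering a target by one lowers its norm. So
  outgoing half-edges can simply be deleted, and once all fixed half-edges are incoming, the tail
  \<open>y\<close> of a deleted edge causes no trouble; at its head \<open>x\<close> half-edges are
  added. An edge weighs \<open>2 * k\<close> in the measure, more than the half-edges replacing
  it.\<close>

lemma all_positive_step:
  fixes k :: int and E :: "'e set"
  assumes mod_instance: "mod_instance k X E t h p q \<tau> {}"
    and slack: "\<And>A. A \<subset> X \<Longrightarrow> card A \<ge> 2 \<Longrightarrow> 2 * k + circ_norm k (sum \<tau> A) \<le> cut_degree E t h p q A"
    and tight: "\<And>v. v \<in> X \<Longrightarrow> cut_degree E t h p q {v} \<le> 2 * k - 2 + circ_norm k (\<tau> v)"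
    and pos: "\<And>v. v \<in> X \<Longrightarrow> 0 < \<tau> v mod (2 * k) \<and> \<tau> v mod (2 * k) < k"
    and e: "e \<in> E" "joins t h e y x"
    and new: "\<And>(E' :: 'e set) p' q' \<tau>'. mod_instance k X E' t h p' q' \<tau>' {} \<Longrightarrow>
        2 * k * int (card E') + sum p' X + sum q' X < 2 * k * int (card E) + sum p X + sum q X \<Longrightarrow>
        solvable k X E' t h p' q' \<tau>'"
  shows "solvable k X E t h p q \<tau>"
proof -
  note fin = mod_instance_finite[OF mod_instance] and k = mod_instance_k[OF mod_instance]
  have xy: "x \<in> X" "y \<in> X" "x \<noteq> y" using e mod_instance_ends[OF mod_instance, of e] by (auto simp: joins_def)
  have down: "circ_norm k (\<tau> v - 1) = circ_norm k (\<tau> v) - 1" if "v \<in> X" for v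
    using circ_norm_diff_1[OF k, of "\<tau> v"] pos[OF that] by simp
  have "card E > 0" using e(1) fin by (auto simp: card_gt_0_iff)
  then have "int (card (E - {e})) = int (card E) - 1" using e(1) fin by simp
  then have card: "2 * k * int (card (E - {e})) = 2 * k * int (card E) - 2 * k" by (simp only: right_diff_distrib mult_1_right)
  have "{x} \<subset> X" using xy by blast
  then have gx: "2 * k - 2 + circ_norm k (\<tau> x) \<le> cut_degree E t h p q {x}" using mod_instance_ge[OF mod_instance, of "{x}"] by simp
  have k2: "k \<ge> 2" using pos[OF xy(1)] by linarith
  show ?thesis
  proof (cases "\<exists>v\<in>X. p v > 0")
    case True
    then obtain v where v: "v \<in> X" "p v > 0" by blast
    show ?thesis
      by (rule stub_update[OF mod_instance v slack down[OF v(1)] tight]) (assumption | rule new | simp)+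
  next
    case False
    then have p0: "p v = 0" if "v \<in> X" for v using that mod_instance_nonneg[OF mod_instance that] by force
    then have sp: "sum p X = 0" by simp
    define Q where "Q = sum q X"
    have Q0: "Q \<ge> 0" unfolding Q_def using mod_instance_nonneg[OF mod_instance] by (auto intro: sum_nonneg)
    have tot: "[sum \<tau> X = - Q] (mod 2 * k)" using mod_instance_total[OF mod_instance] by (simp add: sp Q_def)
    have "\<bar>Q\<bar> \<le> 2 * k - 2 + circ_norm k Q"
      using mod_instance_le[OF mod_instance] circ_norm_cong[OF tot] Q0 by (simp add: sp Q_def)
    then have Qle: "Q \<le> 2 * k - 1" using abs_le_of_circ_norm[OF k] by fastforce
    show ?thesis
    proof (cases "Q = 2 * k - 1")
      case False
      have "[sum \<tau> X - 1 = - Q - 1] (mod 2 * k)" by (rule cong_diff[OF tot cong_refl])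
      then have "circ_norm k (sum \<tau> X - 1) = circ_norm k (- (Q + 1))" by (intro circ_norm_cong) simp
      also have "\<dots> = circ_norm k (Q + 1)" by (rule circ_norm_minus)
      also have "(Q + 1) mod (2 * k) = Q + 1"
        using Q0 Qle False by (intro mod_pos_pos_trivial) linarith+
      then have "circ_norm k (Q + 1) = (if Q + 1 \<le> k then Q + 1 else 2 * k - (Q + 1))"
        by (simp only: circ_norm_eq[OF k])
      finally have "circ_norm k (sum \<tau> X - 1) = (if Q + 1 \<le> k then Q + 1 else 2 * k - (Q + 1))" .
      then have eX: "Q + 1 \<le> 2 * k - 2 + circ_norm k (sum \<tau> X - 1)" using Qle False k2 by (auto split: if_splits)
      show ?thesis
      \<comment> \<open>The edge becomes an incoming half-edge at \<open>x\<close>, so target and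
        cut degree of \<open>x\<close> stay as they are. The bound on \<open>Q + 1\<close> fixed
        half-edges still holds because \<open>Q \<le> 2 * k - 2\<close>.\<close>
      proof (rule edge_update[OF mod_instance e _ _ slack down[OF xy(2)] _ _ tight, of 0 1])
        show "2 * k - 2 + circ_norm k (\<tau> x + (1 - 1 + 0)) \<le> cut_degree E t h p q {x} - 1 + 0 + 1"
          using gx by simp
        show "sum p X + sum q X + 0 + 1 \<le> 2 * k - 2 + circ_norm k (sum \<tau> X - 1 + 0)"
          using eX by (simp add: sp Q_def)
        show "solvable k X (E - {e}) t h p' q' \<tau>'"
          if "mod_instance k X (E - {e}) t h p' q' \<tau>' {}" "sum p' X + sum q' X = sum p X + sum q X + 0 + 1" for p' q' \<tau>'
          by (rule new[OF that(1)]) (use that(2) card k2 in linarith)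
      qed auto
    next
      case True
      \<comment> \<open>There is no room for another incoming half-edge, so \<open>k - r\<close>
        outgoing ones are added at \<open>x\<close> instead. They push its residue to
        \<open>k + 1\<close>, of norm \<open>k - 1\<close>, just compatible with the new cut degree.
        The total target becomes \<open>1 + (k - r)\<close> modulo \<open>2 * k\<close>, so the
        bound on fixed half-edges holds with equality.\<close>
      define r where "r = \<tau> x mod (2 * k)"
      have r: "0 < r" "r < k" "circ_norm k (\<tau> x) = r" using pos[OF xy(1)] by (simp_all add: r_def circ_norm_eq[OF k])
      have "[\<tau> x + (1 + (k - r)) = r + (1 + (k - r))] (mod 2 * k)"
        by (rule cong_add) (auto simp: r_def cong_def)
      then have "circ_norm k (\<tau> x + (1 + (k - r))) = circ_norm k (r + (1 + (k - r)))" by (rule circ_norm_cong)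
      moreover have "r + (1 + (k - r)) = k + 1" by simp
      moreover have "(k + 1) mod (2 * k) = k + 1" using k2 by (intro mod_pos_pos_trivial) linarith+
      ultimately have nx: "circ_norm k (\<tau> x + (1 + (k - r))) = k - 1" by (simp add: circ_norm_eq[OF k])
      have "[sum \<tau> X + (k - r) = - Q + (k - r)] (mod 2 * k)" by (rule cong_add[OF tot cong_refl])
      moreover have "[- Q = 1] (mod 2 * k)" by (simp add: True cong_iff_dvd_diff)
      then have "[- Q + (k - r) = 1 + (k - r)] (mod 2 * k)" by (rule cong_add[OF _ cong_refl])
      ultimately have "circ_norm k (sum \<tau> X + (k - r)) = circ_norm k (1 + (k - r))" using cong_trans circ_norm_cong by blast
      then have nX: "circ_norm k (sum \<tau> X + (k - r)) = 1 + (k - r)" using r by (simp add: circ_norm_small)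
      show ?thesis
      proof (rule edge_update[OF mod_instance e _ _ slack down[OF xy(2)] _ _ tight, of "k - r" 0])
        show "2 * k - 2 + circ_norm k (\<tau> x + (1 - 0 + (k - r))) \<le> cut_degree E t h p q {x} - 1 + (k - r) + 0"
          using gx nx r by auto
        show "sum p X + sum q X + (k - r) + 0 \<le> 2 * k - 2 + circ_norm k (sum \<tau> X - 0 + (k - r))"
          using nX True by (simp add: sp Q_def)
        show "solvable k X (E - {e}) t h p' q' \<tau>'"
          if "mod_instance k X (E - {e}) t h p' q' \<tau>' {}" "sum p' X + sum q' X = sum p X + sum q X + (k - r) + 0" for p' q' \<tau>'
          by (rule new[OF that(1)]) (use that(2) card k2 r in linarith)
      qed (use r in auto)
    qed
  qed
qed

text \<open>A vertex that is not tight can afford to lose 2 from its cut degree, so a pair is split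
  off there: an edge with a half-edge, two edges to different neighbours, or, failing these, two
  parallel edges.\<close>

lemma slack_vertex_step:
  fixes k :: int and E :: "'e set"
  assumes mod_instance: "mod_instance k X E t h p q \<tau> {}" and x: "x \<in> X" "X \<noteq> {x}"
    and slack: "\<And>A. A \<subset> X \<Longrightarrow> card A \<ge> 2 \<Longrightarrow> 2 * k + circ_norm k (sum \<tau> A) \<le> cut_degree E t h p q A"
    and sx: "2 * k + circ_norm k (\<tau> x) \<le> cut_degree E t h p q {x}"
    and new: "\<And>(E' :: 'e set) t' h' p' q'. mod_instance k X E' t' h' p' q' \<tau> {} \<Longrightarrow> card E' < card E \<Longrightarrow>
        sum p' X = sum p X \<Longrightarrow> sum q' X = sum q X \<Longrightarrow> solvable k X E' t' h' p' q' \<tau>"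
  shows "solvable k X E t h p q \<tau>"
proof -
  note fin = mod_instance_finite[OF mod_instance] and k = mod_instance_k[OF mod_instance]
  have "\<exists>e\<in>E. \<exists>y. joins t h e y x"
  proof (rule ccontr)
    assume no: "\<not> ?thesis"
    have "cut_degree E t h p q {x} + cut_degree E t h p q (X - {x}) = sum p X + sum q X"
      by (rule mod_instance_separated[OF mod_instance]) (use no x in auto)
    moreover have "2 * k - 2 + circ_norm k (sum \<tau> (X - {x})) \<le> cut_degree E t h p q (X - {x})"
      by (rule mod_instance_ge[OF mod_instance]) (use x in auto)
    moreover have "circ_norm k (sum \<tau> X) \<le> circ_norm k (\<tau> x) + circ_norm k (sum \<tau> (X - {x}))"
      unfolding sum.remove[OF fin(1) x(1)] by (rule circ_norm_triangle[OF k])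
    ultimately show False using mod_instance_le[OF mod_instance] sx k by linarith
  qed
  then obtain e y where e: "e \<in> E" "joins t h e y x" by blast
  have y: "y \<in> X" "y \<noteq> x" using e mod_instance_ends[OF mod_instance, of e] by (auto simp: joins_def)
  consider (out) "p x > 0" | (inn) "q x > 0" | (zero) "p x = 0" "q x = 0"
    using mod_instance_nonneg[OF mod_instance x(1)] by fastforce
  then show ?thesis
  proof cases
    case out
    show ?thesis
      by (rule lift_stub[OF mod_instance e out slack]) (use sx new card_Diff1_less[OF fin(2) e(1)] in auto)
  next
    case inn
    show ?thesis
      by (rule lift_stub_in[OF mod_instance e inn slack]) (use sx new card_Diff1_less[OF fin(2) e(1)] in auto)
  next
    case zero
    show ?thesis
    proof (cases "\<exists>e'\<in>E. \<exists>w. joins t h e' w x \<and> w \<noteq> y")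
      case True
      then obtain e' w where e': "e' \<in> E" "joins t h e' w x" "w \<noteq> y" by blast
      then have ne: "e \<noteq> e'" using e(2) by (auto simp: joins_def)
      show ?thesis
        by (rule lift_edges[OF mod_instance e e'(1) joins_sym[OF e'(2)] ne slack]) (use sx e' new in auto)
    next
      case False
      have sep: "(t e' \<in> {x}) \<noteq> (h e' \<in> {x}) \<longleftrightarrow> joins t h e' y x" if "e' \<in> E" for e'
        using False that y(2) by (auto simp: joins_def)
      \<comment> \<open>All crossing edges at \<open>x\<close> end in \<open>y\<close>; the slack
        makes its cut degree at least 2.\<close>
      have "\<exists>e'\<in>E. e' \<noteq> e \<and> joins t h e' y x"
      proof (rule ccontr)
        assume no: "\<not> ?thesis"
        have "cut_size E t h {x} = (\<Sum>e'\<in>E. if e' = e then 1 else 0)"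
          unfolding cut_size_def
        proof (rule sum.cong[OF refl])
          fix e' assume "e' \<in> E"
          then show "of_bool ((t e' \<in> {x}) \<noteq> (h e' \<in> {x})) = (if e' = e then 1 else (0 :: int))"
            using no e(2) unfolding sep[OF \<open>e' \<in> E\<close>] by auto
        qed
        then have "cut_degree E t h p q {x} = 1" using fin e(1) by (simp add: cut_degree_def zero)
        then show False using sx k circ_norm_nonneg[OF k, of "\<tau> x"] by linarith
      qed
      then obtain e' where e': "e' \<in> E" "e' \<noteq> e" "joins t h e' y x" by blast
      \<comment> \<open>Splitting off parallel edges produces a loop at \<open>y\<close>, so
        \<open>y\<close> needs slack too. It inherits the slack of \<open>x\<close>, as every
        crossing edge of \<open>x\<close> also crosses \<open>{y}\<close>, and the rest of the
        degree of \<open>y\<close> is the cut degree of \<open>{x, y}\<close>.\<close>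
      have "cut_size E t h {y} = cut_size E t h {x} + cut_size E t h {x, y}"
        unfolding cut_size_def sum.distrib[symmetric]
      proof (rule sum.cong[OF refl])
        fix e' assume "e' \<in> E"
        show "of_bool ((t e' \<in> {y}) \<noteq> (h e' \<in> {y})) = of_bool ((t e' \<in> {x}) \<noteq> (h e' \<in> {x})) +
            (of_bool ((t e' \<in> {x, y}) \<noteq> (h e' \<in> {x, y})) :: int)"
          using sep[OF \<open>e' \<in> E\<close>] y(2) by (auto simp: joins_def)
      qed
      then have vy: "cut_degree E t h p q {y} = cut_degree E t h p q {x} + cut_degree E t h p q {x, y}"
        using y(2) by (simp add: cut_degree_def zero)
      have "circ_norm k (\<tau> x + \<tau> y) \<le> cut_degree E t h p q {x, y}"
      proof (cases "X = {x, y}")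
        case True
        then have "circ_norm k (\<tau> x + \<tau> y) \<le> sum p {x, y} + sum q {x, y}"
          using mod_instance_total_circ_norm[OF mod_instance] y(2) by simp
        then show ?thesis using cut_size_nonneg[of E t h "{x, y}"] by (simp add: cut_degree_def)
      next
        case False
        then have "2 * k - 2 + circ_norm k (sum \<tau> {x, y}) \<le> cut_degree E t h p q {x, y}"
          using mod_instance_ge[OF mod_instance, of "{x, y}"] x y by blast
        then show ?thesis using y(2) k by simp
      qed
      moreover have "circ_norm k (\<tau> y) \<le> circ_norm k (\<tau> x + \<tau> y) + circ_norm k (\<tau> x)"
        using circ_norm_triangle[OF k, of "\<tau> x + \<tau> y" "- \<tau> x"] by simp
      ultimately have "2 * k + circ_norm k (\<tau> y) \<le> cut_degree E t h p q {y}" using vy sx by linarith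
      then show ?thesis
        by (intro lift_edges[OF mod_instance e e'(1) joins_sym[OF e'(3)] e'(2)[symmetric] slack]) (use sx new in auto)
    qed
  qed
qed

theorem mod_instance_solvable:
  fixes k :: int and X :: "'v set" and E :: "'e set"
  assumes "mod_instance k X E t h p q \<tau> Z"
  shows "solvable k X E t h p q \<tau>"
  using assms
proof (induction "card X" arbitrary: X E t h p q \<tau> Z rule: less_induct)
  case less
  have IH: "solvable k X' E' t' h' p' q' \<tau>'"
    if "card X' < card X" "mod_instance k X' E' t' h' p' q' \<tau>' Z'"
    for X' :: "'v set" and E' :: "'e set" and t' h' p' q' \<tau>' Z'
    using less.hyps that by blast
  have special: "solvable k X E' t' h' p' q' \<tau>'" if "mod_instance k X E' t' h' p' q' \<tau>' {x}"
    for E' :: "'e set" and t' h' p' q' \<tau>' x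
    by (rule exempt_vertex_step[OF IH that])
  have plain: "solvable k X E t h p q \<tau>" if "mod_instance k X E t h p q \<tau> {}"
    for E :: "'e set" and t h p q \<tau>
    using that
  \<comment> \<open>With the vertex set fixed, the measure weighs an edge by \<open>2 * k\<close>,
    so that trading one edge for fewer than \<open>2 * k\<close> half-edges is progress.\<close>
  proof (induction "nat (2 * k * int (card E) + sum p X + sum q X)" arbitrary: E t h p q \<tau> rule: less_induct)
    case less
    note mod_instance = less.prems
    note fin = mod_instance_finite[OF mod_instance] and k = mod_instance_k[OF mod_instance]
    have new: "solvable k X E' t' h' p' q' \<tau>'"
      if "mod_instance k X E' t' h' p' q' \<tau>' {}"
        "2 * k * int (card E') + sum p' X + sum q' X < 2 * k * int (card E) + sum p X + sum q X"
      for E' :: "'e set" and t' h' p' q' \<tau>'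
    proof (rule less.hyps[OF _ that(1)])
      have "0 \<le> sum p' X" "0 \<le> sum q' X" using mod_instance_nonneg[OF that(1)] by (auto intro: sum_nonneg)
      then have "0 \<le> 2 * k * int (card E') + sum p' X + sum q' X" using k by simp
      then show "nat (2 * k * int (card E') + sum p' X + sum q' X) < nat (2 * k * int (card E) + sum p X + sum q X)"
        using that(2) by linarith
    qed
    have new': "solvable k X E' t' h' p' q' \<tau>'"
      if "mod_instance k X E' t' h' p' q' \<tau>' {}" "card E' < card E" "sum p' X = sum p X" "sum q' X = sum q X"
      for E' :: "'e set" and t' h' p' q' \<tau>'
      by (rule new[OF that(1)]) (use that k in auto)
    consider "X = {}" | x where "X = {x}" | (two) "card X \<ge> 2"
      using card_cases[OF fin(1)] by blast
    then show ?case
    proof cases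
      case 1
      then show ?thesis by (intro solvableI[of "\<lambda>_. 1"]) auto
    next
      case (2 x)
      then show ?thesis by (rule solvable_single[OF mod_instance])
    next
      case two
      have proper: "{v} \<subset> X" if "v \<in> X" for v using that two by auto
      show ?thesis
      proof (cases "\<exists>A. A \<subset> X \<and> card A \<ge> 2 \<and> cut_degree E t h p q A \<le> 2 * k - 2 + circ_norm k (sum \<tau> A)")
        case True
        then obtain A where A: "A \<subset> X" "card A \<ge> 2" "cut_degree E t h p q A \<le> 2 * k - 2 + circ_norm k (sum \<tau> A)" by blast
        show ?thesis by (rule contract_tight_set[OF mod_instance A]) (rule IH)
      next
        case no_tight: False
        have slack: "2 * k + circ_norm k (sum \<tau> A) \<le> cut_degree E t h p q A" if "A \<subset> X" "card A \<ge> 2" for A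
          by (rule mod_instance_slack[OF mod_instance]) (use that no_tight in auto)
        show ?thesis
        proof (cases "\<exists>x\<in>X. \<not> cut_degree E t h p q {x} \<le> 2 * k - 2 + circ_norm k (\<tau> x)")
          case True
          then obtain x where x: "x \<in> X" "\<not> cut_degree E t h p q {x} \<le> 2 * k - 2 + circ_norm k (\<tau> x)" by blast
          then have "2 * k + circ_norm k (\<tau> x) \<le> cut_degree E t h p q {x}"
            using mod_instance_slack[OF mod_instance, of "{x}"] proper by auto
          then show ?thesis
            by (intro slack_vertex_step[OF mod_instance x(1) _ slack _ new']) (use two in auto)
        next
          case False
          then have tight: "cut_degree E t h p q {v} \<le> 2 * k - 2 + circ_norm k (\<tau> v)" if "v \<in> X" for v using that by blast
          show ?thesis
          proof (cases "\<exists>x\<in>X. circ_norm k (\<tau> x) = 0")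
            case True
            then obtain x where "x \<in> X" "circ_norm k (\<tau> x) = 0" by blast
            then have "mod_instance k X E t h p q \<tau> {x}" by (rule mod_instance_exempt_vertex[OF mod_instance])
            then show ?thesis by (rule special)
          next
            case False
            have range: "0 < \<tau> v mod (2 * k)" "\<tau> v mod (2 * k) < 2 * k" if "v \<in> X" for v
            proof -
              have "\<tau> v mod (2 * k) \<noteq> 0" using False that circ_norm_eq_0_iff[OF k, of "\<tau> v"] by auto
              then show "0 < \<tau> v mod (2 * k)" using k pos_mod_sign[of "2 * k" "\<tau> v"] by linarith
              show "\<tau> v mod (2 * k) < 2 * k" using k by (intro pos_mod_bound) linarith
            qed
            have val_pos: "cut_degree E t h p q A \<ge> 1" if A: "A \<noteq> {}" "A \<subset> X" for A
              using finite_subset[OF psubset_imp_subset[OF A(2)] fin(1)] A(1)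
            proof (cases rule: card_cases)
              case (1 v)
              then have "circ_norm k (\<tau> v) \<noteq> 0" using False A by auto
              then show ?thesis using 1 mod_instance_ge[OF mod_instance A(1,2,1)] circ_norm_nonneg[OF k, of "\<tau> v"] k by simp
            next
              case 2
              then show ?thesis using slack[OF A(2)] circ_norm_nonneg[OF k, of "sum \<tau> A"] k by fastforce
            qed
            \<comment> \<open>Otherwise the degree conditions of \<open>B\<close> and its complement
              add up to at least \<open>4 * k - 4 + circ_norm k (sum \<tau> X)\<close> fixed
              half-edges, too many if \<open>k \<ge> 2\<close>. For \<open>k = 1\<close>,
              \<open>val_pos\<close> gives at least 2 of them while at most 1 is permitted.\<close>
            have conn: "\<exists>e\<in>E. \<exists>x\<in>B. \<exists>y\<in>X - B. joins t h e y x" if B: "B \<noteq> {}" "B \<subset> X" for B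
            proof (rule ccontr)
              assume no: "\<not> ?thesis"
              let ?C = "X - B"
              have C: "?C \<noteq> {}" "?C \<subset> X" using B by auto
              have "cut_degree E t h p q B + cut_degree E t h p q ?C = sum p X + sum q X"
                by (rule mod_instance_separated[OF mod_instance B]) (use no in blast)
              moreover have "circ_norm k (sum \<tau> X) \<le> circ_norm k (sum \<tau> ?C) + circ_norm k (sum \<tau> B)"
                unfolding sum.subset_diff[OF psubset_imp_subset[OF B(2)] fin(1)] by (rule circ_norm_triangle[OF k])
              ultimately show False
                using mod_instance_ge[OF mod_instance B(1,2,1)] mod_instance_ge[OF mod_instance C(1,2,1)] val_pos[OF B] val_pos[OF C]
                  mod_instance_le[OF mod_instance] circ_norm_le[OF k, of "sum \<tau> X"] k by linarith
            qed
            show ?thesis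
            \<comment> \<open>Directing such an edge from \<open>y\<close> to \<open>x\<close> moves
              both targets towards 0, so it can be deleted without adding half-edges.\<close>
            proof (cases "\<exists>e\<in>E. \<exists>x y. joins t h e y x \<and> \<tau> y mod (2 * k) \<le> k \<and> k \<le> \<tau> x mod (2 * k)")
              case True
              then obtain e x y where e: "e \<in> E" "joins t h e y x" and m: "\<tau> y mod (2 * k) \<le> k" "k \<le> \<tau> x mod (2 * k)"
                by blast
              have xy: "x \<in> X" "y \<in> X" using e mod_instance_ends[OF mod_instance, of e] by (auto simp: joins_def)
              have "card E > 0" using e(1) fin by (auto simp: card_gt_0_iff)
              then have "int (card (E - {e})) = int (card E) - 1" using e(1) fin by simp
              then have card: "2 * k * int (card (E - {e})) = 2 * k * int (card E) - 2 * k" by (simp only: right_diff_distrib mult_1_right)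
              show ?thesis
              proof (rule edge_update[OF mod_instance e _ _ slack circ_norm_diff_1[OF k range(1)[OF xy(2)] m(1)] _ _ tight, of 0 0])
                show "2 * k - 2 + circ_norm k (\<tau> x + (1 - 0 + 0)) \<le> cut_degree E t h p q {x} - 1 + 0 + 0"
                  using mod_instance_ge[OF mod_instance, of "{x}"] proper[OF xy(1)] circ_norm_add_1[OF k m(2)] by simp
                show "sum p X + sum q X + 0 + 0 \<le> 2 * k - 2 + circ_norm k (sum \<tau> X - 0 + 0)" using mod_instance_le[OF mod_instance] by simp
                show "solvable k X (E - {e}) t h p' q' \<tau>'"
                  if "mod_instance k X (E - {e}) t h p' q' \<tau>' {}" "sum p' X + sum q' X = sum p X + sum q X + 0 + 0" for p' q' \<tau>'
                  by (rule new[OF that(1)]) (use that(2) card k in linarith)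
              qed auto
            next
              case no_opp: False
              \<comment> \<open>A residue equal to \<open>k\<close> belongs to both halves of the
                circle, so any edge at \<open>v\<close> would be of the excluded kind.\<close>
              have no_mid: "\<tau> v mod (2 * k) \<noteq> k" if v: "v \<in> X" for v
              proof
                assume "\<tau> v mod (2 * k) = k"
                moreover obtain e y where "e \<in> E" "y \<in> X - {v}" "joins t h e y v"
                  using conn[of "{v}"] proper[OF v] by blast
                ultimately show False using no_opp joins_sym by (metis linear)
              qed
              obtain v0 where v0: "v0 \<in> X" using two by fastforce
              obtain e y where e: "e \<in> E" "joins t h e y v0" using conn[of "{v0}"] proper[OF v0] by blast
              \<comment> \<open>By \<open>conn\<close>, vertices in both open halves would yield an
                edge between the halves; hence all residues lie in the same one.\<close>
              define P where "P = {v \<in> X. \<tau> v mod (2 * k) < k}"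
              have "P = {} \<or> P = X"
              proof (rule ccontr)
                assume "\<not> ?thesis"
                then obtain e x y where "e \<in> E" "x \<in> P" "y \<in> X - P" "joins t h e y x"
                  using conn[of P] by (auto simp: P_def)
                moreover then have "\<tau> x mod (2 * k) \<le> k" "k \<le> \<tau> y mod (2 * k)" by (auto simp: P_def)
                ultimately show False using no_opp joins_sym by metis
              qed
              then show ?thesis
              proof
                assume "P = X"
                then have pos: "0 < \<tau> v mod (2 * k) \<and> \<tau> v mod (2 * k) < k" if "v \<in> X" for v
                  using that range by (auto simp: P_def)
                show ?thesis by (rule all_positive_step[OF mod_instance slack tight pos e new])
              next
                assume "P = {}"
                have pos: "0 < (- \<tau> v) mod (2 * k) \<and> (- \<tau> v) mod (2 * k) < k" if v: "v \<in> X" for v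
                proof -
                  have "k < \<tau> v mod (2 * k)" using \<open>P = {}\<close> no_mid[OF v] v by (force simp: P_def)
                  then show ?thesis using range[OF v] by (simp add: zmod_zminus1_eq_if)
                qed
                show ?thesis
                proof (rule solvable_reverse, rule all_positive_step[OF mod_instance_reverse[OF mod_instance] _ _ pos e])
                  show "2 * k + circ_norm k (\<Sum>v\<in>A. - \<tau> v) \<le> cut_degree E t h q p A" if "A \<subset> X" "card A \<ge> 2" for A
                    using slack[OF that] by (simp add: sum_negf cut_degree_commute)
                  show "cut_degree E t h q p {v} \<le> 2 * k - 2 + circ_norm k (- \<tau> v)" if "v \<in> X" for v
                    using tight[OF that] by (simp add: cut_degree_commute)
                qed (auto intro: new)
              qed
            qed
          qed
        qed
      qed
    qed
  qed
  from mod_instance_exempt[OF less.prems] show ?case using plain special less.prems by blast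
qed

section \<open>Spanning subgraphs from orientations\<close>

text \<open>An entry of the incidence matrix, equal to 2 for a loop, in agreement with
  \<open>degree\<close>.\<close>

definition incidence :: "'v set \<Rightarrow> 'v \<Rightarrow> int" where
  "incidence S v = of_bool (v \<in> S) + of_bool (S = {v})"

lemma incidence_pair: "incidence {u, w} v = of_bool (u = v) + of_bool (w = v)"
  by (auto simp: incidence_def)

lemma incidence_nonneg: "0 \<le> incidence S v"
  by (simp add: incidence_def)

lemma ends_pair:
  assumes "fin_multigraph G" "e \<in> edges G" "v \<in> ends G e"
  obtains u where "ends G e = {u, v}"
proof -
  have "\<exists>u. ends G e = {u, v}"
    using fin_multigraph.card_ends[OF assms(1,2)] assms(3)
    by (auto simp: card_1_singleton_iff card_2_iff insert_commute)
  then show ?thesis using that by blast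
qed

lemma ends_nonempty:
  assumes "fin_multigraph G" "e \<in> edges G"
  obtains v where "v \<in> ends G e"
  using fin_multigraph.card_ends[OF assms] by fastforce

lemma degree_eq:
  assumes "finite (edges G)"
  shows "int (degree G v) = (\<Sum>e\<in>edges G. incidence (ends G e) v)"
  using assms by (simp add: degree_def incidence_def sum.distrib Int_def)

lemma sum_incidence_weighted:
  assumes G: "fin_multigraph G" "e \<in> edges G" and c: "\<And>v. v \<in> ends G e \<Longrightarrow> w v = (c :: int)"
  shows "(\<Sum>v\<in>verts G. w v * incidence (ends G e) v) = 2 * c"
proof -
  obtain v u where uv: "ends G e = {u, v}" using ends_nonempty[OF G] ends_pair[OF G] by metis
  have "u \<in> verts G" "v \<in> verts G" using fin_multigraph.ends_subset[OF G] uv by auto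
  then show ?thesis using fin_multigraph.finite_verts[OF G(1)] c[of u] c[of v] uv
    by (simp add: incidence_pair distrib_left sum.distrib of_bool_def if_distrib[of "(*) _"] cong: if_cong)
qed

text \<open>An edge has two ends, possibly equal, and is in the boundary iff exactly one of them
  counts as inside. So taking boundaries is linear over the field with two elements.\<close>

lemma boundary_sym_diff:
  assumes "fin_multigraph G"
  shows "boundary G (sym_diff A B) = sym_diff (boundary G A) (boundary G B)"
proof -
  have "e \<in> boundary G (sym_diff A B) \<longleftrightarrow> e \<in> sym_diff (boundary G A) (boundary G B)" for e
  proof (cases "e \<in> edges G")
    case True
    then obtain v u where "ends G e = {u, v}" using ends_nonempty[OF assms] ends_pair[OF assms] by metis
    then show ?thesis using True by (auto simp: boundary_def)
  qed (simp add: boundary_def)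
  then show ?thesis by blast
qed

text \<open>Switching the sides of the vertices of \<open>A\<close> replaces the cut of
  \<open>Z\<close> by its symmetric difference with the cut of \<open>A\<close>. If \<open>Z\<close>
  is maximum, the edges gained do not outnumber the edges lost, which are those common to both
  cuts.\<close>

lemma max_cut:
  assumes "fin_multigraph G"
  obtains Z where "Z \<subseteq> verts G"
    "\<And>A. A \<subseteq> verts G \<Longrightarrow> card (boundary G A) \<le> 2 * card (boundary G Z \<inter> boundary G A)"
proof -
  have fE: "finite (edges G)" and fV: "finite (verts G)"
    using assms by (simp_all add: fin_multigraph.finite_edges fin_multigraph.finite_verts)
  have fb: "finite (boundary G A)" for A using fE by (simp add: boundary_def)
  have "\<exists>Z. Z \<in> Pow (verts G) \<and> (\<forall>Y. Y \<in> Pow (verts G) \<longrightarrow> card (boundary G Y) \<le> card (boundary G Z))"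
    by (rule ex_has_greatest_nat[where b = "Suc (card (edges G))" and k = "{}"])
      (auto simp: boundary_def less_Suc_eq_le intro!: card_mono fE)
  then obtain Z where Z: "Z \<subseteq> verts G"
    and max: "\<And>Y. Y \<subseteq> verts G \<Longrightarrow> card (boundary G Y) \<le> card (boundary G Z)" by blast
  show ?thesis
  proof (rule that[OF Z])
    fix A assume A: "A \<subseteq> verts G"
    let ?z = "boundary G Z" and ?a = "boundary G A"
    have "card (?z - ?a) + card (?a - ?z) = card (sym_diff ?z ?a)"
      using fb by (subst card_Un_disjoint) auto
    also have "\<dots> = card (boundary G (sym_diff Z A))" by (simp add: boundary_sym_diff[OF assms])
    also have "\<dots> \<le> card ?z" by (rule max) (use Z A in auto)
    finally have "card (?z - ?a) + card (?a - ?z) \<le> card ?z" .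
    moreover have "card ?z = card (?z - ?a) + card (?z \<inter> ?a)"
      using card_Diff_subset_Int[of ?z ?a] card_mono[of ?z "?z \<inter> ?a"] fb by fastforce
    moreover have "card ?a = card (?a - ?z) + card (?z \<inter> ?a)"
      using card_Diff_subset_Int[of ?a ?z] card_mono[of ?a "?a \<inter> ?z"] fb by (simp add: Int_commute)
    ultimately show "card ?a \<le> 2 * card (?z \<inter> ?a)" by linarith
  qed
qed

text \<open>The crossing edges of a cut form a bipartite spanning subgraph. This supplies the inner
  edges whose signs adjust the total.\<close>

lemma bipartite_index_le_cut:
  assumes "fin_multigraph G" "Z \<subseteq> verts G"
  shows "bipartite_index G \<le> card (edges G - boundary G Z)"
  unfolding bipartite_index_def
proof (rule Least_le, intro exI conjI)
  let ?H = "\<lparr>verts = verts G, edges = boundary G Z, ends = ends G\<rparr>"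
  show "spanning_subgraph ?H G" by (auto simp: spanning_subgraph_def boundary_def)
  show "bipartite ?H" unfolding bipartite_def
  proof (rule exI[of _ Z], rule exI[of _ "verts G - Z"], intro conjI ballI)
    fix e assume "e \<in> edges ?H"
    then have e: "e \<in> edges G" "ends G e \<inter> Z \<noteq> {}" "ends G e - Z \<noteq> {}" by (auto simp: boundary_def)
    then obtain x y where "x \<in> ends G e" "x \<in> Z" "y \<in> ends G e" "y \<notin> Z" by blast
    moreover obtain u where "ends G e = {u, x}" using ends_pair[OF assms(1) e(1)] \<open>x \<in> ends G e\<close> by blast
    moreover have "ends G e \<subseteq> verts G" by (rule fin_multigraph.ends_subset[OF assms(1) e(1)])
    ultimately show "\<exists>x\<in>Z. \<exists>y\<in>verts G - Z. ends ?H e = {x, y}"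
      by (intro bexI[of _ x] bexI[of _ y]) auto
  qed (use assms(2) in auto)
  show "card (edges G - boundary G Z) = card (edges G - edges ?H)" by simp
qed

text \<open>Greedy choice: as long as two members have meeting sets, they are taken out as a pair,
  recorded by \<open>\<pi>\<close>.\<close>

lemma adjacent_pairing:
  assumes "finite F"
  obtains D N and \<pi> :: "'e \<Rightarrow> 'e" where "inj_on \<pi> D" "D \<inter> \<pi> ` D = {}" "N \<inter> (D \<union> \<pi> ` D) = {}"
    "F = D \<union> \<pi> ` D \<union> N" "\<And>e. e \<in> D \<Longrightarrow> r e \<inter> r (\<pi> e) \<noteq> {}"
    "\<And>e e'. e \<in> N \<Longrightarrow> e' \<in> N \<Longrightarrow> e \<noteq> e' \<Longrightarrow> r e \<inter> r e' = {}"
proof -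
  define P where "P F D N \<pi> \<longleftrightarrow> inj_on \<pi> D \<and> D \<inter> \<pi> ` D = {} \<and> N \<inter> (D \<union> \<pi> ` D) = {} \<and>
    F = D \<union> \<pi> ` D \<union> N \<and> (\<forall>e\<in>D. r e \<inter> r (\<pi> e) \<noteq> {}) \<and>
    (\<forall>e\<in>N. \<forall>e'\<in>N. e \<noteq> e' \<longrightarrow> r e \<inter> r e' = {})" for F D N and \<pi> :: "'e \<Rightarrow> 'e"
  have "\<exists>D N \<pi>. P F D N \<pi>"
    using assms
  proof (induction F rule: finite_psubset_induct)
    case (psubset F)
    show ?case
    proof (cases "\<exists>e\<in>F. \<exists>e'\<in>F. e \<noteq> e' \<and> r e \<inter> r e' \<noteq> {}")
      case True
      then obtain e e' where e: "e \<in> F" "e' \<in> F" "e \<noteq> e'" "r e \<inter> r e' \<noteq> {}" by blast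
      have "F - {e, e'} \<subset> F" using e by blast
      then obtain D N \<pi> where "P (F - {e, e'}) D N \<pi>" using psubset.IH by blast
      then have D: "inj_on \<pi> D" "D \<inter> \<pi> ` D = {}" "N \<inter> (D \<union> \<pi> ` D) = {}"
        "F - {e, e'} = D \<union> \<pi> ` D \<union> N" "\<forall>e\<in>D. r e \<inter> r (\<pi> e) \<noteq> {}"
        "\<forall>e\<in>N. \<forall>e'\<in>N. e \<noteq> e' \<longrightarrow> r e \<inter> r e' = {}"
        unfolding P_def by simp_all
      have nD: "e \<notin> D" "e' \<notin> D" "e \<notin> \<pi> ` D" "e' \<notin> \<pi> ` D" "e \<notin> N" "e' \<notin> N" using D(4) by blast+
      define \<rho> where "\<rho> = \<pi>(e := e')"
      have im: "\<rho> ` insert e D = insert e' (\<pi> ` D)" using nD by (auto simp: \<rho>_def)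
      have "inj_on \<rho> (insert e D)"
        using D(1) nD by (auto simp: \<rho>_def inj_on_def)
      moreover have "insert e D \<inter> \<rho> ` insert e D = {}" unfolding im using D(2) nD e by auto
      moreover have "N \<inter> (insert e D \<union> \<rho> ` insert e D) = {}" unfolding im using D(3) nD by auto
      moreover have "F = insert e D \<union> \<rho> ` insert e D \<union> N" unfolding im using D(4) e by auto
      moreover have "\<forall>d\<in>insert e D. r d \<inter> r (\<rho> d) \<noteq> {}" using D(5) e nD by (auto simp: \<rho>_def)
      ultimately have "P F (insert e D) N \<rho>" unfolding P_def using D(6) by (intro conjI)
      then show ?thesis by blast
    next
      case False
      then have "P F {} F \<pi>" for \<pi> unfolding P_def by auto
      then show ?thesis by blast
    qed
  qed
  then obtain D N \<pi> where "P F D N \<pi>" by blast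
  then have D: "inj_on \<pi> D" "D \<inter> \<pi> ` D = {}" "N \<inter> (D \<union> \<pi> ` D) = {}" "F = D \<union> \<pi> ` D \<union> N"
    "\<forall>e\<in>D. r e \<inter> r (\<pi> e) \<noteq> {}" "\<forall>e\<in>N. \<forall>e'\<in>N. e \<noteq> e' \<longrightarrow> r e \<inter> r e' = {}"
    unfolding P_def by simp_all
  show ?thesis
  proof (rule that[OF D(1-4)])
    show "r e \<inter> r (\<pi> e) \<noteq> {}" if "e \<in> D" for e using D(5) that by simp
    show "r e \<inter> r e' = {}" if "e \<in> N" "e' \<in> N" "e \<noteq> e'" for e e' using D(6) that by simp
  qed
qed

section \<open>Signs of the edges\<close>

text \<open>The sums of \<open>k - 1\<close> signs are the \<open>k\<close> numbers from
  \<open>-(k - 1)\<close> to \<open>k - 1\<close> in steps of 2. For odd \<open>k\<close> they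
  represent all residues modulo \<open>k\<close>, for even \<open>k\<close> exactly those with the
  parity of \<open>k - 1\<close>.\<close>

lemma exists_residue:
  fixes k g :: int
  assumes "k \<ge> 1" "even k \<Longrightarrow> even (g - (k - 1))"
  obtains j where "\<bar>j\<bar> \<le> k - 1" "even (j - (k - 1))" "[j = g] (mod k)"
proof -
  define r where "r = g mod k"
  have r: "0 \<le> r" "r < k" "[r = g] (mod k)" using assms(1) by (simp_all add: r_def cong_def)
  show ?thesis
  proof (cases "even (r - (k - 1))")
    case True
    then show ?thesis using that[of r] r by simp
  next
    \<comment> \<open>Subtracting the odd number \<open>k\<close> corrects the parity. The result is
      at least \<open>-(k - 1)\<close>, because \<open>r\<close> is odd here and thus not 0.\<close>
    case False
    have "odd k"
    proof
      assume "even k"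
      then have "even r \<longleftrightarrow> even g" by (simp add: r_def dvd_mod_iff)
      then show False using False assms(2)[OF \<open>even k\<close>] by simp
    qed
    then have "r \<noteq> 0" using False by auto
    moreover have "[r - k = g] (mod k)" using r(3) by (simp add: cong_def)
    ultimately show ?thesis using that[of "r - k"] r False \<open>odd k\<close> by auto
  qed
qed

text \<open>The edges of sign 1 form \<open>H\<close>, so \<open>2 * degree H v\<close> is
  \<open>degree G v\<close> plus the signed sum at \<open>v\<close>. Halving gives the congruence
  modulo \<open>k\<close>, and rounding turns the asymmetric interval from
  \<open>- 2 * k + 1\<close> to \<open>2 * k\<close> into the asymmetric degree bounds.\<close>

lemma subgraph_of_signing:
  fixes G :: "('v, 'e) multigraph" and k :: nat and f :: "'v \<Rightarrow> int"
  assumes G: "fin_multigraph G" and s: "\<forall>e. s e = 1 \<or> s e = (- 1 :: int)"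
    and b: "\<And>v. v \<in> verts G \<Longrightarrow> [(\<Sum>e\<in>edges G. s e * incidence (ends G e) v) = 2 * f v - int (degree G v)] (mod 2 * int k)"
      "\<And>v. v \<in> verts G \<Longrightarrow> - 2 * int k + 1 \<le> (\<Sum>e\<in>edges G. s e * incidence (ends G e) v)"
      "\<And>v. v \<in> verts G \<Longrightarrow> (\<Sum>e\<in>edges G. s e * incidence (ends G e) v) \<le> 2 * int k"
  shows "\<exists>H. spanning_subgraph H G \<and>
           (\<forall>v \<in> verts G.
              [int (degree H v) = f v] (mod int k) \<and>
              int (degree G v div 2) - (int k - 1) \<le> int (degree H v) \<and>
              int (degree H v) \<le> int (degree G v div 2) + int k)"
proof (intro exI conjI ballI)
  note fE = fin_multigraph.finite_edges[OF G]
  let ?H = "\<lparr>verts = verts G, edges = {e \<in> edges G. s e = 1}, ends = ends G\<rparr>"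
  show "spanning_subgraph ?H G" by (simp add: spanning_subgraph_def)
  fix v assume v: "v \<in> verts G"
  let ?b = "\<Sum>e\<in>edges G. s e * incidence (ends G e) v"
  have "2 * int (degree ?H v) = (\<Sum>e\<in>edges G. 2 * (if s e = 1 then incidence (ends G e) v else 0))"
    using degree_eq[of ?H v] fE by (simp add: sum.inter_filter sum_distrib_left)
  also have "\<dots> = (\<Sum>e\<in>edges G. incidence (ends G e) v + s e * incidence (ends G e) v)"
    by (rule sum.cong[OF refl]) (use s in auto)
  finally have H: "2 * int (degree ?H v) = int (degree G v) + ?b"
    by (simp add: sum.distrib degree_eq[OF fE])
  have "[int (degree G v) + ?b = int (degree G v) + (2 * f v - int (degree G v))] (mod 2 * int k)"
    by (rule cong_add[OF cong_refl b(1)[OF v]])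
  then have "[2 * int (degree ?H v) = 2 * f v] (mod 2 * int k)" unfolding H by simp
  then show "[int (degree ?H v) = f v] (mod int k)" by (simp add: cong_def)
  show "int (degree G v div 2) - (int k - 1) \<le> int (degree ?H v)"
    using H b(2)[OF v] by linarith
  show "int (degree ?H v) \<le> int (degree G v div 2) + int k"
    using H b(3)[OF v] by linarith
qed

text \<open>
  The edges \<open>e\<close> and \<open>\<pi> e\<close>, for \<open>e \<in> D\<close>, form a pair that receives opposite signs. The signs of the edges in \<open>R\<close>
  are chosen so that the total is right; those of the leftover edges \<open>N\<close> are given by \<open>\<nu>\<close>.
\<close>

lemma signing_exists:
  fixes G :: "('v, 'e) multigraph" and k :: int and f :: "'v \<Rightarrow> int"
  assumes G: "fin_multigraph G" and k: "k \<ge> 1" and Z: "Z \<subseteq> verts G"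
    and cut: "\<And>A. A \<noteq> {} \<Longrightarrow> A \<subset> verts G \<Longrightarrow> 3 * k - 3 \<le> int (card (boundary G Z \<inter> boundary G A))"
    and even_f: "even ((k - 1) * (\<Sum>v\<in>verts G. f v))"
    and R: "R \<subseteq> edges G - boundary G Z" "int (card R) = k - 1"
    and D: "inj_on \<pi> D" "D \<inter> \<pi> ` D = {}" "N \<inter> (D \<union> \<pi> ` D) = {}"
      "edges G - boundary G Z - R = D \<union> \<pi> ` D \<union> N" "\<And>e. e \<in> D \<Longrightarrow> ends G e \<inter> ends G (\<pi> e) \<noteq> {}"
    and \<nu>: "\<forall>e. \<nu> e = 1 \<or> \<nu> e = (- 1 :: int)"
  obtains s where "\<forall>e. s e = 1 \<or> s e = (- 1 :: int)" "\<And>e. e \<in> N \<Longrightarrow> s e = \<nu> e"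
    "\<And>v. v \<in> verts G \<Longrightarrow> \<bar>\<Sum>e\<in>edges G - N. s e * incidence (ends G e) v\<bar> \<le> 2 * k - 1"
    "\<And>v. v \<in> verts G \<Longrightarrow> [(\<Sum>e\<in>edges G. s e * incidence (ends G e) v) = 2 * f v - int (degree G v)] (mod 2 * k)"
proof -
  define V where "V = verts G"
  define C where "C = boundary G Z"
  define m where "m e v = incidence (ends G e) v" for e v
  have fE: "finite (edges G)" and fV: "finite V"
    using G by (simp_all add: V_def fin_multigraph.finite_edges fin_multigraph.finite_verts)
  have C: "C \<subseteq> edges G" by (auto simp: C_def boundary_def)
  have split: "edges G - N = C \<union> (D \<union> (\<pi> ` D \<union> R))" "edges G = (edges G - N) \<union> N"
    "C \<inter> (D \<union> (\<pi> ` D \<union> R)) = {}" "D \<inter> (\<pi> ` D \<union> R) = {}" "\<pi> ` D \<inter> R = {}" "(edges G - N) \<inter> N = {}"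
    "N \<subseteq> edges G - C"
    using C R(1) D(2,3,4) unfolding C_def by blast+
  have fin: "finite C" "finite D" "finite (\<pi> ` D)" "finite R" "finite N"
    using finite_subset[OF _ fE] split(1,2) by (metis Un_subset_iff Diff_subset sup_ge1 sup_ge2 subset_trans)+
  have sum_EN: "(\<Sum>e\<in>edges G - N. g e) = (\<Sum>e\<in>C. g e) + ((\<Sum>e\<in>D. g e + g (\<pi> e)) + (\<Sum>e\<in>R. g e))" for g :: "'e \<Rightarrow> int"
    using fin split(3,4,5) unfolding split(1)
    by (simp add: sum.union_disjoint sum.reindex[OF D(1)] sum.distrib)
  have sum_E: "(\<Sum>e\<in>edges G. g e) = (\<Sum>e\<in>edges G - N. g e) + (\<Sum>e\<in>N. g e)" for g :: "'e \<Rightarrow> int"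
    by (rule sum.subset_diff) (use split(7) fE in auto)

  \<comment> \<open>Multiplying the condition at \<open>v\<close> by \<open>\<epsilon> v\<close>
    turns the sign of a crossing edge into a direction, with 1 meaning away from \<open>Z\<close>.
    For an inner edge, \<open>\<epsilon>e\<close> is the common value at its ends.\<close>
  define \<epsilon> where "\<epsilon> v = (if v \<in> Z then 1 else - 1 :: int)" for v
  define \<epsilon>e where "\<epsilon>e e = (if ends G e \<subseteq> Z then 1 else - 1 :: int)" for e
  have \<epsilon>2: "\<epsilon> v * \<epsilon> v = 1" "\<epsilon> v = 1 \<or> \<epsilon> v = - 1" for v by (auto simp: \<epsilon>_def)
  have \<epsilon>e: "\<epsilon> v = \<epsilon>e e" if "e \<in> edges G - C" "v \<in> ends G e" for e v
    using that by (auto simp: \<epsilon>_def \<epsilon>e_def C_def boundary_def)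

  \<comment> \<open>A crossing edge gets its end in \<open>Z\<close> as tail. A pair
    \<open>e\<close>, \<open>\<pi> e\<close> with common end \<open>v\<close> becomes an edge from
    the other end of \<open>e\<close> to the other end of \<open>\<pi> e\<close>; with opposite
    signs the contributions at \<open>v\<close> cancel.\<close>
  define Q where "Q e u w \<longleftrightarrow> u \<in> V \<and> w \<in> V \<and> (e \<in> C \<longrightarrow> u \<in> Z \<and> w \<notin> Z \<and> ends G e = {u, w}) \<and>
      (e \<in> D \<longrightarrow> (\<exists>v. ends G e = {u, v} \<and> ends G (\<pi> e) = {w, v}))" for e u w
  have "\<exists>u w. Q e u w" if e: "e \<in> C \<union> D" for e
  proof (cases "e \<in> C")
    case True
    then have eE: "e \<in> edges G" "ends G e \<inter> Z \<noteq> {}" "ends G e - Z \<noteq> {}" by (auto simp: C_def boundary_def)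
    then obtain x y where "x \<in> ends G e" "x \<in> Z" "y \<in> ends G e" "y \<notin> Z" by blast
    moreover obtain u where "ends G e = {u, x}" using ends_pair[OF G eE(1)] \<open>x \<in> ends G e\<close> by blast
    moreover have "ends G e \<subseteq> V" unfolding V_def by (rule fin_multigraph.ends_subset[OF G eE(1)])
    moreover have "e \<notin> D" using True split(3) by blast
    ultimately have "Q e x y" by (auto simp: Q_def)
    then show ?thesis by blast
  next
    case False
    then have eD: "e \<in> D" using e by blast
    then have eE: "e \<in> edges G" "\<pi> e \<in> edges G" using D(4) by blast+
    obtain v where v: "v \<in> ends G e" "v \<in> ends G (\<pi> e)" using D(5)[OF eD] by blast
    obtain u where u: "ends G e = {u, v}" using ends_pair[OF G eE(1) v(1)] by blast
    obtain w where w: "ends G (\<pi> e) = {w, v}" using ends_pair[OF G eE(2) v(2)] by blast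
    have "u \<in> V" "w \<in> V" unfolding V_def
      using fin_multigraph.ends_subset[OF G eE(1)] fin_multigraph.ends_subset[OF G eE(2)] u w by auto
    then have "Q e u w" using u w False by (auto simp: Q_def)
    then show ?thesis by blast
  qed
  then have "\<forall>e\<in>C \<union> D. \<exists>u w. Q e u w" by blast
  from bchoice[OF this] obtain t where "\<forall>e\<in>C \<union> D. \<exists>w. Q e (t e) w" by blast
  from bchoice[OF this] obtain h where Q: "\<forall>e\<in>C \<union> D. Q e (t e) (h e)" by blast
  have th: "t e \<in> V \<and> h e \<in> V" if "e \<in> C \<union> D" for e using Q that by (simp add: Q_def)
  have thC: "t e \<in> Z \<and> h e \<notin> Z \<and> ends G e = {t e, h e}" if "e \<in> C" for e using Q that by (simp add: Q_def)
  have thD: "\<exists>v. ends G e = {t e, v} \<and> ends G (\<pi> e) = {h e, v}" if "e \<in> D" for e using Q that by (simp add: Q_def)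

  have mC: "m e v = of_bool (t e = v) + of_bool (h e = v)" if "e \<in> C" for e v
    using thC[OF that] by (simp add: m_def incidence_pair)
  have mC_signed: "\<epsilon> v * m e v = of_bool (t e = v) - of_bool (h e = v)" if "e \<in> C" for e v
    using thC[OF that] by (auto simp: m_def incidence_pair \<epsilon>_def)
  have \<epsilon>D: "\<epsilon> (t e) = \<epsilon>e e" "\<epsilon> (h e) = \<epsilon>e e" if e: "e \<in> D" for e
  proof -
    obtain v where v: "ends G e = {t e, v}" "ends G (\<pi> e) = {h e, v}" using thD[OF e] by blast
    have "e \<in> edges G - C" "\<pi> e \<in> edges G - C" using e D(4) by (auto simp: C_def)
    then show "\<epsilon> (t e) = \<epsilon>e e" "\<epsilon> (h e) = \<epsilon>e e"
      using \<epsilon>e[of e "t e"] \<epsilon>e[of e v] \<epsilon>e[of "\<pi> e" "h e"] \<epsilon>e[of "\<pi> e" v] v by simp_all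
  qed
  have mD: "\<exists>u. \<forall>v. m e v = of_bool (t e = v) + of_bool (u = v) \<and> m (\<pi> e) v = of_bool (h e = v) + of_bool (u = v)"
    if e: "e \<in> D" for e
  proof -
    obtain u where u: "ends G e = {t e, u}" "ends G (\<pi> e) = {h e, u}" using thD[OF e] by blast
    have "m e v = of_bool (t e = v) + of_bool (u = v) \<and> m (\<pi> e) v = of_bool (h e = v) + of_bool (u = v)" for v
      unfolding m_def u incidence_pair by simp
    then show ?thesis by blast
  qed
  have mD_signed: "m e v - m (\<pi> e) v = of_bool (t e = v) - of_bool (h e = v)" if "e \<in> D" for e v
    using mD[OF that] by auto
  have mD_even: "even (m e v + m (\<pi> e) v - (of_bool (t e = v) + of_bool (h e = v)))" if "e \<in> D" for e v
    using mD[OF that] by auto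

  define d where "d v = (\<Sum>e\<in>edges G. m e v)" for v
  define n where "n v = (\<Sum>e\<in>N. \<nu> e * m e v)" for v
  \<comment> \<open>The wanted signed sum at \<open>v\<close>, less the contribution of the leftover
    edges, in the sign convention of the side of \<open>v\<close>.\<close>
  define \<tau> where "\<tau> v = \<epsilon> v * (2 * f v - d v - n v)" for v
  have d: "int (degree G v) = d v" for v unfolding d_def m_def by (rule degree_eq[OF fE])
  have weigh: "(\<Sum>v\<in>V. \<epsilon> v * m e v) = 2 * \<epsilon>e e" if "e \<in> edges G - C" for e
    unfolding m_def V_def by (rule sum_incidence_weighted[OF G]) (use that \<epsilon>e in auto)
  have weighC: "(\<Sum>v\<in>V. \<epsilon> v * m e v) = 0" if "e \<in> C" for e
  proof -
    have "(\<Sum>v\<in>V. \<epsilon> v * m e v) = (\<Sum>v\<in>V. of_bool (t e = v) - of_bool (h e = v))"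
      by (rule sum.cong[OF refl]) (rule mC_signed[OF that])
    also have "\<dots> = 0" using th[of e] that sum_of_bool_eq[OF fV, of "t e" True] sum_of_bool_eq[OF fV, of "h e" True]
      by (simp add: sum_subtractf)
    finally show ?thesis .
  qed

  \<comment> \<open>Half of the total target. The total congruence modulo \<open>2 * k\<close>
    therefore amounts to \<open>[j = g] (mod k)\<close>, where \<open>j\<close> is the sum of the
    signs on \<open>R\<close>.\<close>
  define g where "g = (\<Sum>v\<in>V. \<epsilon> v * f v) - (\<Sum>e\<in>edges G - C. \<epsilon>e e) - (\<Sum>e\<in>N. \<nu> e * \<epsilon>e e)"
  have \<tau>V: "sum \<tau> V = 2 * g"
  proof -
    have "(\<Sum>v\<in>V. \<epsilon> v * d v) = (\<Sum>e\<in>edges G. \<Sum>v\<in>V. \<epsilon> v * m e v)"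
      unfolding d_def sum_distrib_left by (rule sum.swap)
    also have "\<dots> = (\<Sum>e\<in>edges G - C. \<Sum>v\<in>V. \<epsilon> v * m e v) + (\<Sum>e\<in>C. \<Sum>v\<in>V. \<epsilon> v * m e v)"
      by (rule sum.subset_diff[OF C fE])
    also have "\<dots> = (\<Sum>e\<in>edges G - C. 2 * \<epsilon>e e)" using weigh weighC by simp
    finally have 1: "(\<Sum>v\<in>V. \<epsilon> v * d v) = 2 * (\<Sum>e\<in>edges G - C. \<epsilon>e e)" by (simp add: sum_distrib_left)
    have "(\<Sum>v\<in>V. \<epsilon> v * n v) = (\<Sum>e\<in>N. \<Sum>v\<in>V. \<epsilon> v * (\<nu> e * m e v))"
      unfolding n_def sum_distrib_left by (rule sum.swap)
    also have "\<dots> = (\<Sum>e\<in>N. \<nu> e * (\<Sum>v\<in>V. \<epsilon> v * m e v))" by (simp add: sum_distrib_left algebra_simps)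
    also have "\<dots> = (\<Sum>e\<in>N. \<nu> e * (2 * \<epsilon>e e))"
      by (rule sum.cong[OF refl]) (use weigh split(7) in auto)
    also have "\<dots> = 2 * (\<Sum>e\<in>N. \<nu> e * \<epsilon>e e)" by (simp add: sum_distrib_left algebra_simps)
    finally have 2: "(\<Sum>v\<in>V. \<epsilon> v * n v) = 2 * (\<Sum>e\<in>N. \<nu> e * \<epsilon>e e)" .
    have "sum \<tau> V = 2 * (\<Sum>v\<in>V. \<epsilon> v * f v) - (\<Sum>v\<in>V. \<epsilon> v * d v) - (\<Sum>v\<in>V. \<epsilon> v * n v)"
    proof -
      have "sum \<tau> V = (\<Sum>v\<in>V. 2 * (\<epsilon> v * f v) - \<epsilon> v * d v - \<epsilon> v * n v)"
        by (rule sum.cong[OF refl]) (simp add: \<tau>_def algebra_simps)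
      then show ?thesis by (simp only: sum_subtractf sum_distrib_left)
    qed
    then show ?thesis unfolding 1 2 g_def by simp
  qed

  have parity_sum: "even (sum w S) \<longleftrightarrow> even (card S)" if "\<And>e. odd (w e)" for w :: "'e \<Rightarrow> int" and S
    using that by (induction S rule: infinite_finite_induct) auto
  \<comment> \<open>Signs do not affect parity. The sum of \<open>f\<close> is even, and as pairs
    count twice, the inner edges and the leftover ones together have the parity of
    \<open>card R = k - 1\<close>.\<close>
  have g_parity: "even (g - (k - 1))" if ek: "even k"
  proof -
    have "even (\<Sum>v\<in>V. f v)" using even_f ek by (simp add: V_def)
    moreover have "even ((\<Sum>v\<in>V. \<epsilon> v * f v) - (\<Sum>v\<in>V. f v))"
      unfolding sum_subtractf[symmetric] by (rule dvd_sum) (auto simp: \<epsilon>_def)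
    ultimately have "even (\<Sum>v\<in>V. \<epsilon> v * f v)" by simp
    moreover have "even (\<Sum>e\<in>edges G - C. \<epsilon>e e) \<longleftrightarrow> even (card (edges G - C))"
      by (rule parity_sum) (simp add: \<epsilon>e_def)
    moreover have "odd (\<nu> e * \<epsilon>e e)" for e using spec[OF \<nu>, of e] by (auto simp: \<epsilon>e_def)
    then have "even (\<Sum>e\<in>N. \<nu> e * \<epsilon>e e) \<longleftrightarrow> even (card N)" by (rule parity_sum)
    moreover have "card (edges G - C) = card (R \<union> (D \<union> (\<pi> ` D \<union> N)))"
      using R(1) D(4) by (intro arg_cong[where f = card]) (auto simp: C_def)
    moreover have "\<dots> = card R + (card D + (card D + card N))"
      using fin D(2,3) R(1) D(4) split(4,5) card_image[OF D(1)]
      by (subst card_Un_disjoint; auto simp: C_def)+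
    moreover have "odd (int (card R))" unfolding R(2) using ek by simp
    then have "odd (card R)" by simp
    ultimately show ?thesis using ek by (auto simp: g_def)
  qed
  obtain j where j: "\<bar>j\<bar> \<le> k - 1" "even (j - (k - 1))" "[j = g] (mod k)"
    using exists_residue[OF k g_parity] by blast
  obtain \<sigma> where \<sigma>: "\<forall>e. \<sigma> e = 1 \<or> \<sigma> e = (- 1 :: int)" "sum \<sigma> R = j"
    using signs_with_sum[OF fin(4), of j] j R(2) by auto

  \<comment> \<open>Both ends of an edge in \<open>R\<close> become fixed half-edges, outgoing or
    incoming according to \<open>\<sigma>\<close>. They number \<open>2 * k - 2\<close>, which is
    within the bound for every total target.\<close>
  define p where "p v = (\<Sum>e\<in>R. of_bool (\<sigma> e = 1) * m e v)" for v
  define q where "q v = (\<Sum>e\<in>R. of_bool (\<sigma> e = - 1) * m e v)" for v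
  have pq_diff: "p v - q v = (\<Sum>e\<in>R. \<sigma> e * m e v)" for v
    unfolding p_def q_def sum_subtractf[symmetric]
    by (rule sum.cong[OF refl]) (use \<sigma>(1) in \<open>auto simp: algebra_simps\<close>)
  have pq_sum: "p v + q v = (\<Sum>e\<in>R. m e v)" for v
    unfolding p_def q_def sum.distrib[symmetric]
  proof (rule sum.cong[OF refl])
    fix e assume "e \<in> R"
    show "of_bool (\<sigma> e = 1) * m e v + of_bool (\<sigma> e = - 1) * m e v = m e v"
      using spec[OF \<sigma>(1), of e] by auto
  qed
  have two: "(\<Sum>v\<in>V. m e v) = 2" if "e \<in> edges G" for e
    using sum_incidence_weighted[OF G that, of "\<lambda>_. 1" 1] by (simp add: m_def V_def)
  have RE: "R \<subseteq> edges G" using R(1) by blast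
  have pqV_sum: "sum p V + sum q V = 2 * (k - 1)"
  proof -
    have "sum p V + sum q V = (\<Sum>e\<in>R. \<Sum>v\<in>V. m e v)"
      unfolding sum.distrib[symmetric] pq_sum by (rule sum.swap)
    also have "\<dots> = (\<Sum>e\<in>R. 2)" by (rule sum.cong[OF refl]) (use two RE in auto)
    finally show ?thesis using R(2) by simp
  qed
  have pqV_diff: "sum p V - sum q V = 2 * j"
  proof -
    have "sum p V - sum q V = (\<Sum>e\<in>R. \<Sum>v\<in>V. \<sigma> e * m e v)"
      unfolding sum_subtractf[symmetric] pq_diff by (rule sum.swap)
    also have "\<dots> = (\<Sum>e\<in>R. \<sigma> e * 2)"
      by (rule sum.cong[OF refl]) (use two RE in \<open>auto simp: sum_distrib_left[symmetric]\<close>)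
    finally show ?thesis using \<sigma>(2) by (simp add: sum_distrib_right[symmetric])
  qed

  \<comment> \<open>The number of edge ends and fixed half-edges at \<open>v\<close> in the new
    instance. Modulo 2 it agrees with \<open>\<tau> v\<close>, and summed over \<open>A\<close> with
    the cut degree of \<open>A\<close>.\<close>
  define w where "w v = (\<Sum>e\<in>C \<union> D. of_bool (t e = v) + of_bool (h e = v)) + (p v + q v)" for v
  have CD: "C \<inter> D = {}" using split(3) by blast
  have \<tau>_w: "even (\<tau> v - w v)" for v
  proof -
    have "d v = (\<Sum>e\<in>C. m e v) + ((\<Sum>e\<in>D. m e v + m (\<pi> e) v) + (\<Sum>e\<in>R. m e v)) + (\<Sum>e\<in>N. m e v)"
      unfolding d_def sum_E sum_EN ..
    moreover have "w v = (\<Sum>e\<in>C. of_bool (t e = v) + of_bool (h e = v)) + (\<Sum>e\<in>D. of_bool (t e = v) + of_bool (h e = v))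
        + (\<Sum>e\<in>R. m e v)"
      unfolding w_def pq_sum by (simp only: sum.union_disjoint[OF fin(1,2) CD])
    moreover have "(\<Sum>e\<in>C. m e v) = (\<Sum>e\<in>C. of_bool (t e = v) + of_bool (h e = v))"
      by (rule sum.cong[OF refl]) (rule mC)
    ultimately have "d v + n v - w v = (\<Sum>e\<in>D. m e v + m (\<pi> e) v - (of_bool (t e = v) + of_bool (h e = v)))
        + (\<Sum>e\<in>N. m e v + \<nu> e * m e v)"
      by (simp only: sum_subtractf sum.distrib n_def)
    moreover have "even (\<Sum>e\<in>D. m e v + m (\<pi> e) v - (of_bool (t e = v) + of_bool (h e = v)))"
      by (rule dvd_sum) (rule mD_even)
    moreover have "even (m e v + \<nu> e * m e v)" for e using spec[OF \<nu>, of e] by auto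
    then have "even (\<Sum>e\<in>N. m e v + \<nu> e * m e v)" by (intro dvd_sum)
    ultimately have "even (d v + n v - w v)" by simp
    then show ?thesis using \<epsilon>2(2)[of v] by (auto simp: \<tau>_def)
  qed
  have parity: "even (sum \<tau> A) \<longleftrightarrow> even (cut_degree (C \<union> D) t h p q A)" if A: "A \<subseteq> V" for A
  proof -
    have fA: "finite A" using A fV finite_subset by blast
    have "(\<Sum>v\<in>A. of_bool (u = v)) = (of_bool (u \<in> A) :: int)" for u
      using sum_of_bool_eq[OF fA, of u True] by simp
    then have "(\<Sum>v\<in>A. \<Sum>e\<in>C \<union> D. of_bool (t e = v) + of_bool (h e = v))
        = (\<Sum>e\<in>C \<union> D. of_bool (t e \<in> A) + of_bool (h e \<in> A) :: int)"
      by (subst sum.swap) (simp only: sum.distrib)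
    then have "sum w A - cut_degree (C \<union> D) t h p q A =
        (\<Sum>e\<in>C \<union> D. of_bool (t e \<in> A) + of_bool (h e \<in> A) - of_bool ((t e \<in> A) \<noteq> (h e \<in> A)))"
      unfolding w_def cut_degree_def cut_size_def sum_subtractf by (simp only: sum.distrib)
    also have "even \<dots>" by (rule dvd_sum) auto
    finally have "even (sum w A - cut_degree (C \<union> D) t h p q A)" .
    moreover have "even (sum \<tau> A - sum w A)" unfolding sum_subtractf[symmetric] by (rule dvd_sum) (rule \<tau>_w)
    ultimately show ?thesis by auto
  qed
  have pq_nonneg: "0 \<le> p v \<and> 0 \<le> q v" for v
    unfolding p_def q_def by (auto intro!: sum_nonneg mult_nonneg_nonneg simp: m_def incidence_nonneg)
  have "mod_instance k V (C \<union> D) t h p q \<tau> {}"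
  proof (rule mod_instanceI[OF fV _ k th pq_nonneg parity])
    show "finite (C \<union> D)" using fin by blast
    have "[2 * g = 2 * j] (mod 2 * k)" using cong_sym[OF j(3)] by (simp add: cong_def)
    then show "[sum \<tau> V = sum p V - sum q V] (mod 2 * k)" by (simp add: \<tau>V pqV_diff)
    show "sum p V + sum q V \<le> 2 * k - 2 + circ_norm k (sum \<tau> V)"
      using circ_norm_nonneg[OF k, of "sum \<tau> V"] by (simp add: pqV_sum)
    fix A assume A: "A \<noteq> {}" "A \<subset> V"
    have "int (card (C \<inter> boundary G A)) = (\<Sum>e\<in>C. of_bool (e \<in> boundary G A))"
      using fin(1) by simp
    also have "\<dots> = (\<Sum>e\<in>C. of_bool ((t e \<in> A) \<noteq> (h e \<in> A)))"
    proof (rule sum.cong[OF refl])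
      fix e assume e: "e \<in> C"
      have "e \<in> boundary G A \<longleftrightarrow> (t e \<in> A) \<noteq> (h e \<in> A)"
        using thC[OF e] e C by (auto simp: boundary_def)
      then show "of_bool (e \<in> boundary G A) = (of_bool ((t e \<in> A) \<noteq> (h e \<in> A)) :: int)" by simp
    qed
    also have "\<dots> \<le> cut_size (C \<union> D) t h A"
      unfolding cut_size_def by (rule sum_mono2) (use fin in auto)
    also have "\<dots> \<le> cut_degree (C \<union> D) t h p q A"
      using pq_nonneg by (simp add: cut_degree_def sum_nonneg)
    finally have ge: "3 * k - 3 \<le> cut_degree (C \<union> D) t h p q A"
      using cut[of A] A by (simp add: C_def V_def)
    show "2 * k - 2 + circ_norm k (sum \<tau> A) \<le> cut_degree (C \<union> D) t h p q A"
    \<comment> \<open>The bound \<open>3 * k - 3\<close> misses the requirement only for the largest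
      norm \<open>k\<close>, and then only by 1. Parity makes up for it, since
      \<open>3 * k - 3\<close> and \<open>k\<close> differ in parity.\<close>
    proof (cases "circ_norm k (sum \<tau> A) = k")
      case True
      then have "even k \<longleftrightarrow> even (cut_degree (C \<union> D) t h p q A)"
        using parity[of A] A even_circ_norm_iff[OF k, of "sum \<tau> A"] by auto
      then have "cut_degree (C \<union> D) t h p q A \<noteq> 3 * k - 3" by auto
      then show ?thesis using True ge by linarith
    next
      case False
      then show ?thesis using circ_norm_le[OF k, of "sum \<tau> A"] ge by linarith
    qed
  qed simp_all
  then have "solvable k V (C \<union> D) t h p q \<tau>" by (rule mod_instance_solvable)
  then obtain s0 where s0: "\<forall>e. s0 e = 1 \<or> s0 e = (- 1 :: int)"
    and c0: "\<And>v. v \<in> V \<Longrightarrow> [net_out (C \<union> D) t h s0 {v} + p v - q v = \<tau> v] (mod 2 * k)"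
    and b0: "\<And>v. v \<in> V \<Longrightarrow> \<bar>net_out (C \<union> D) t h s0 {v} + p v - q v\<bar> \<le> 2 * k - 1"
    unfolding solvable_def by blast

  define \<rho> where "\<rho> = inv_into D \<pi>"
  have \<rho>: "\<rho> (\<pi> e) = e" if "e \<in> D" for e unfolding \<rho>_def by (rule inv_into_f_f[OF D(1) that])
  \<comment> \<open>Directions are translated back into signs: a crossing edge is positive iff it
    leaves \<open>Z\<close>, whereas inner edges need the factor \<open>\<epsilon>e\<close>, with
    opposite signs on each pair.\<close>
  define s where "s e = (if e \<in> C then s0 e else if e \<in> D then \<epsilon>e e * s0 e
      else if e \<in> \<pi> ` D then - (\<epsilon>e (\<rho> e) * s0 (\<rho> e)) else if e \<in> R then \<epsilon>e e * \<sigma> e else \<nu> e)" for e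
  have s_pm: "\<forall>e. s e = 1 \<or> s e = - 1"
  proof
    fix e show "s e = 1 \<or> s e = - 1"
      using spec[OF s0, of e] spec[OF s0, of "\<rho> e"] spec[OF \<sigma>(1), of e] spec[OF \<nu>, of e]
      by (auto simp: s_def \<epsilon>e_def)
  qed
  have sD: "s e = \<epsilon>e e * s0 e" "s (\<pi> e) = - (\<epsilon>e e * s0 e)" if "e \<in> D" for e
  proof -
    have "e \<notin> C" "\<pi> e \<notin> C" "\<pi> e \<notin> D" "\<pi> e \<in> \<pi> ` D" using that split(3) D(2) by auto
    then show "s e = \<epsilon>e e * s0 e" "s (\<pi> e) = - (\<epsilon>e e * s0 e)" using that by (simp_all add: s_def \<rho>)
  qed
  have sR: "s e = \<epsilon>e e * \<sigma> e" if "e \<in> R" for e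
    using that split(3,4,5) by (auto simp: s_def)
  have sN: "s e = \<nu> e" if "e \<in> N" for e
    using that D(3,4) split(7) by (auto simp: s_def C_def)
  have main: "(\<Sum>e\<in>edges G - N. s e * m e v) = \<epsilon> v * (net_out (C \<union> D) t h s0 {v} + p v - q v)" for v
  proof -
    have c1: "\<epsilon> v * (s e * m e v) = s0 e * (of_bool (t e \<in> {v}) - of_bool (h e \<in> {v}))" if "e \<in> C" for e
      using mC_signed[OF that, of v] that by (simp add: s_def)
    have c2: "\<epsilon> v * (s e * m e v + s (\<pi> e) * m (\<pi> e) v) = s0 e * (of_bool (t e \<in> {v}) - of_bool (h e \<in> {v}))"
      if "e \<in> D" for e
    proof -
      have "\<epsilon> v * (s e * m e v + s (\<pi> e) * m (\<pi> e) v) = \<epsilon> v * \<epsilon>e e * s0 e * (m e v - m (\<pi> e) v)"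
        by (simp add: sD[OF that] algebra_simps)
      also have "\<dots> = \<epsilon> v * \<epsilon>e e * s0 e * (of_bool (t e = v) - of_bool (h e = v))"
        by (simp only: mD_signed[OF that])
      also have "\<dots> = s0 e * (of_bool (t e = v) - of_bool (h e = v))"
        using \<epsilon>D[OF that] \<epsilon>2(1)[of v] by auto
      finally show ?thesis by simp
    qed
    have c3: "\<epsilon> v * (s e * m e v) = \<sigma> e * m e v" if "e \<in> R" for e
    proof (cases "v \<in> ends G e")
      case True
      then have "\<epsilon>e e = \<epsilon> v" using \<epsilon>e[of e v] that R(1) by (auto simp: C_def)
      then show ?thesis using \<epsilon>2(1)[of v] by (simp add: sR[OF that] mult.assoc[symmetric])
    next
      case False
      then have "m e v = 0" by (auto simp: m_def incidence_def)
      then show ?thesis by simp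
    qed
    have "\<epsilon> v * (\<Sum>e\<in>edges G - N. s e * m e v) = (\<Sum>e\<in>C. \<epsilon> v * (s e * m e v)) +
        ((\<Sum>e\<in>D. \<epsilon> v * (s e * m e v + s (\<pi> e) * m (\<pi> e) v)) + (\<Sum>e\<in>R. \<epsilon> v * (s e * m e v)))"
      unfolding sum_EN by (simp only: distrib_left sum_distrib_left)
    also have "\<dots> = (\<Sum>e\<in>C. s0 e * (of_bool (t e \<in> {v}) - of_bool (h e \<in> {v}))) +
        ((\<Sum>e\<in>D. s0 e * (of_bool (t e \<in> {v}) - of_bool (h e \<in> {v}))) + (\<Sum>e\<in>R. \<sigma> e * m e v))"
      by (intro arg_cong2[where f = "(+)"] sum.cong refl) (fact c1 c2 c3)+
    also have "\<dots> = net_out (C \<union> D) t h s0 {v} + (p v - q v)"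
      unfolding net_out_def sum.union_disjoint[OF fin(1,2) CD] pq_diff by simp
    finally have "\<epsilon> v * (\<Sum>e\<in>edges G - N. s e * m e v) = net_out (C \<union> D) t h s0 {v} + (p v - q v)" .
    then have "\<epsilon> v * (\<epsilon> v * (\<Sum>e\<in>edges G - N. s e * m e v)) = \<epsilon> v * (net_out (C \<union> D) t h s0 {v} + p v - q v)"
      by simp
    then show ?thesis by (simp only: mult.assoc[symmetric] \<epsilon>2(1) mult_1)
  qed
  show ?thesis
  proof (rule that[OF s_pm sN])
    fix v assume "v \<in> verts G"
    then have v: "v \<in> V" by (simp add: V_def)
    let ?i = "net_out (C \<union> D) t h s0 {v} + p v - q v"
    have i: "(\<Sum>e\<in>edges G - N. s e * incidence (ends G e) v) = \<epsilon> v * ?i" using main[of v] by (simp add: m_def)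
    show "\<bar>\<Sum>e\<in>edges G - N. s e * incidence (ends G e) v\<bar> \<le> 2 * k - 1"
      unfolding i using b0[OF v] \<epsilon>2(2)[of v] by (auto simp: abs_mult)
    have "(\<Sum>e\<in>N. s e * m e v) = n v" unfolding n_def by (rule sum.cong[OF refl]) (simp add: sN)
    then have "(\<Sum>e\<in>edges G. s e * incidence (ends G e) v) = \<epsilon> v * ?i + n v"
      unfolding sum_E i by (simp add: m_def)
    moreover have "[\<epsilon> v * ?i + n v = \<epsilon> v * \<tau> v + n v] (mod 2 * k)"
      by (intro cong_add cong_mult cong_refl c0[OF v])
    moreover have "\<epsilon> v * \<tau> v + n v = 2 * f v - d v"
      by (simp add: \<tau>_def mult.assoc[symmetric] \<epsilon>2(1))
    ultimately show "[(\<Sum>e\<in>edges G. s e * incidence (ends G e) v) = 2 * f v - int (degree G v)] (mod 2 * k)"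
      by (simp add: d)
  qed
qed

section \<open>The leftover edges and the final bounds\<close>

text \<open>A vertex lies in at most one of the disjoint sets, so the leftover edges disturb the
  signed sum at a vertex by a single term.\<close>

lemma sum_disjoint_ends:
  assumes "finite N" and disj: "\<And>e e'. e \<in> N \<Longrightarrow> e' \<in> N \<Longrightarrow> e \<noteq> e' \<Longrightarrow> r e \<inter> r e' = {}"
  shows "(\<Sum>e\<in>N. s e * incidence (r e) v) = 0 \<or>
    (\<exists>e\<in>N. v \<in> r e \<and> (\<Sum>e\<in>N. s e * incidence (r e) v) = s e * incidence (r e) v)"
proof (cases "\<exists>e\<in>N. v \<in> r e")
  case True
  then obtain e where e: "e \<in> N" "v \<in> r e" by blast
  have "(\<Sum>e'\<in>N - {e}. s e' * incidence (r e') v) = 0"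
  proof (rule sum.neutral, rule ballI)
    fix e' assume "e' \<in> N - {e}"
    then have "v \<notin> r e'" using disj[of e e'] e by blast
    then show "s e' * incidence (r e') v = 0" by (auto simp: incidence_def)
  qed
  then have "(\<Sum>e\<in>N. s e * incidence (r e) v) = s e * incidence (r e) v" by (simp add: sum.remove[OF assms(1) e(1)])
  then show ?thesis using e by blast
next
  case False
  then have "(\<Sum>e\<in>N. s e * incidence (r e) v) = 0" by (intro sum.neutral) (auto simp: incidence_def)
  then show ?thesis ..
qed

theorem theorem1p3:
  fixes G :: "('v, 'e) multigraph" and k :: nat and f :: "'v \<Rightarrow> int"
  assumes "fin_multigraph G"
    and "k \<ge> 1"
    and "int (bipartite_index G) \<ge> int k - 1"
    and "even ((int k - 1) * (\<Sum>v\<in>verts G. f v))"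
    and "edge_connected (6 * int k - 7) G"
  shows "\<exists>H. spanning_subgraph H G \<and>
           (\<forall>v \<in> verts G.
              [int (degree H v) = f v] (mod int k) \<and>
              int (degree G v div 2) - (int k - 1) \<le> int (degree H v) \<and>
              int (degree H v) \<le> int (degree G v div 2) + int k)"
proof -
  note G = assms(1)
  have fE: "finite (edges G)" by (rule fin_multigraph.finite_edges[OF G])
  have k: "int k \<ge> 1" using assms(2) by simp
  obtain Z where Z: "Z \<subseteq> verts G"
    and max: "\<And>A. A \<subseteq> verts G \<Longrightarrow> card (boundary G A) \<le> 2 * card (boundary G Z \<inter> boundary G A)"
    using max_cut[OF G] by blast
  \<comment> \<open>The maximum cut contains at least half of the \<open>6 * k - 7\<close> edges,
    and rounding up gives \<open>3 * k - 3\<close>.\<close>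
  have cut: "3 * int k - 3 \<le> int (card (boundary G Z \<inter> boundary G A))" if "A \<noteq> {}" "A \<subset> verts G" for A
  proof -
    have "6 * int k - 7 \<le> int (card (boundary G A))" using assms(5) that by (simp add: edge_connected_def)
    then show ?thesis using max[of A] that by auto
  qed
  have "k - 1 \<le> card (edges G - boundary G Z)"
    using bipartite_index_le_cut[OF G Z] assms(3) by linarith
  then obtain R where R: "R \<subseteq> edges G - boundary G Z" "card R = k - 1"
    by (metis obtain_subset_with_card_n)
  then have cR: "int (card R) = int k - 1" using assms(2) by simp
  have fF: "finite (edges G - boundary G Z - R)" using fE by simp
  obtain D N and \<pi> :: "'e \<Rightarrow> 'e" where D: "inj_on \<pi> D" "D \<inter> \<pi> ` D = {}" "N \<inter> (D \<union> \<pi> ` D) = {}"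
    "edges G - boundary G Z - R = D \<union> \<pi> ` D \<union> N" "\<And>e. e \<in> D \<Longrightarrow> ends G e \<inter> ends G (\<pi> e) \<noteq> {}"
    and disj: "\<And>e e'. e \<in> N \<Longrightarrow> e' \<in> N \<Longrightarrow> e \<noteq> e' \<Longrightarrow> ends G e \<inter> ends G e' = {}"
    by (rule adjacent_pairing[OF fF, where r = "ends G"], rule that)
  have NE: "N \<subseteq> edges G" using D(4) by blast
  then have fN: "finite N" using fE finite_subset by blast
  have sum_E: "(\<Sum>e\<in>edges G. g e) = (\<Sum>e\<in>edges G - N. g e) + (\<Sum>e\<in>N. g e)" for g :: "'e \<Rightarrow> int"
    by (rule sum.subset_diff[OF NE fE])
  have N_sum: "(\<Sum>e\<in>N. s e * incidence (ends G e) v) = 0 \<or>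
    (\<exists>e\<in>N. v \<in> ends G e \<and> (\<Sum>e\<in>N. s e * incidence (ends G e) v) = s e * incidence (ends G e) v)" for s v
    by (rule sum_disjoint_ends[OF fN disj])
  have mlt_N: "incidence (ends G e) v = 1" if "v \<in> ends G e" "ends G e \<noteq> {v}" for e v
    using that by (simp add: incidence_def)
  note signing = signing_exists[OF G k Z cut assms(4) R(1) cR D]
  show ?thesis
  \<comment> \<open>A leftover loop adds 2 or -2 to a sum of absolute value at most
    \<open>2 * k - 1\<close>. If \<open>k \<ge> 2\<close>, the residue at its vertex tells in
    advance which sign is safe; for \<open>k = 1\<close> the residues 1 and -1 coincide and the
    choice has to wait.\<close>
  proof (cases "k = 1")
    case False
    then have k2: "int k \<ge> 2" using assms(2) by linarith
    \<comment> \<open>A positive loop fails only at the value \<open>2 * k + 1\<close>, that is,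
      only for residue 1, where the sign -1 is taken instead. Non-loops get the default 1, which
      stays within the upper bound \<open>2 * k\<close>.\<close>
    define \<nu> where "\<nu> e = (if \<exists>v. ends G e = {v} \<and> [2 * f v - int (degree G v) = 1] (mod 2 * int k)
        then - 1 else 1 :: int)" for e
    have \<nu>: "\<forall>e. \<nu> e = 1 \<or> \<nu> e = - 1" by (simp add: \<nu>_def)
    obtain s where s: "\<forall>e. s e = 1 \<or> s e = (- 1 :: int)" and sN: "\<And>e. e \<in> N \<Longrightarrow> s e = \<nu> e"
      and bound: "\<And>v. v \<in> verts G \<Longrightarrow> \<bar>\<Sum>e\<in>edges G - N. s e * incidence (ends G e) v\<bar> \<le> 2 * int k - 1"
      and cong: "\<And>v. v \<in> verts G \<Longrightarrow> [(\<Sum>e\<in>edges G. s e * incidence (ends G e) v) = 2 * f v - int (degree G v)] (mod 2 * int k)"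
      by (rule signing[OF _ _ _ \<nu>], assumption, assumption, assumption, rule that)
    have "- 2 * int k + 1 \<le> (\<Sum>e\<in>edges G. s e * incidence (ends G e) v) \<and>
        (\<Sum>e\<in>edges G. s e * incidence (ends G e) v) \<le> 2 * int k" if v: "v \<in> verts G" for v
    proof -
      let ?b = "\<Sum>e\<in>edges G. s e * incidence (ends G e) v"
      note b = sum_E[of "\<lambda>e. s e * incidence (ends G e) v"]
      consider (none) "(\<Sum>e\<in>N. s e * incidence (ends G e) v) = 0"
        | (one) e where "e \<in> N" "v \<in> ends G e" "(\<Sum>e\<in>N. s e * incidence (ends G e) v) = s e * incidence (ends G e) v"
        using N_sum[of s v] by blast
      then show ?thesis
      proof cases
        case none
        then show ?thesis using b bound[OF v] by linarith
      next
        case (one e)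
        show ?thesis
        proof (cases "ends G e = {v}")
          case loop: True
          show ?thesis
          proof (cases "[2 * f v - int (degree G v) = 1] (mod 2 * int k)")
            case True
            then have "s e = - 1" using sN[OF one(1)] loop by (auto simp: \<nu>_def)
            then have le: "?b \<le> 2 * int k" "- 2 * int k - 1 \<le> ?b"
              using one(3) b bound[OF v] loop by (auto simp: incidence_def)
            \<comment> \<open>The forbidden values \<open>- 2 * k\<close> and
              \<open>- 2 * k - 1\<close> have residues 0 and -1, both different from 1 since
              \<open>k \<ge> 2\<close>.\<close>
            have "[?b = 1] (mod 2 * int k)" by (rule cong_trans[OF cong[OF v] True])
            then have "2 * int k dvd ?b - 1 + 2 * int k" by (simp add: cong_iff_dvd_diff)
            then have "?b - 1 + 2 * int k = 0 \<or> \<bar>2 * int k\<bar> \<le> \<bar>?b - 1 + 2 * int k\<bar>"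
              using dvd_imp_le_int by blast
            then show ?thesis using le k2 by linarith
          next
            case False
            then have "s e = 1" using sN[OF one(1)] loop by (auto simp: \<nu>_def)
            then have le: "?b \<le> 2 * int k + 1" "- 2 * int k + 1 \<le> ?b"
              using one(3) b bound[OF v] loop by (auto simp: incidence_def)
            have "?b \<noteq> 2 * int k + 1"
            proof
              assume "?b = 2 * int k + 1"
              then have "[1 = ?b] (mod 2 * int k)" by (simp add: cong_def)
              from cong_sym[OF cong_trans[OF this cong[OF v]]] show False using False by simp
            qed
            then show ?thesis using le by linarith
          qed
        next
          case False
          then have "s e = 1" using sN[OF one(1)] one(2) by (auto simp: \<nu>_def)
          then show ?thesis using one(3) b bound[OF v] mlt_N[OF one(2) False] by simp linarith
        qed
      qed
    qed
    then show ?thesis by (intro subgraph_of_signing[OF G s cong]) auto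
  next
    case True
    obtain s where s: "\<forall>e. s e = 1 \<or> s e = (- 1 :: int)" and sN: "\<And>e. e \<in> N \<Longrightarrow> s e = 1"
      and bound: "\<And>v. v \<in> verts G \<Longrightarrow> \<bar>\<Sum>e\<in>edges G - N. s e * incidence (ends G e) v\<bar> \<le> 2 * int k - 1"
      and cong: "\<And>v. v \<in> verts G \<Longrightarrow> [(\<Sum>e\<in>edges G. s e * incidence (ends G e) v) = 2 * f v - int (degree G v)] (mod 2 * int k)"
      by (rule signing[where \<nu> = "\<lambda>_. 1"], assumption, assumption, assumption, simp, rule that)
    define i where "i v = (\<Sum>e\<in>edges G - N. s e * incidence (ends G e) v)" for v
    \<comment> \<open>Modulo \<open>2 * k = 2\<close> the sign of a leftover loop is immaterial, so it can be chosen at the end.\<close>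
    define s' where "s' e = (if e \<in> N \<and> (\<exists>v. ends G e = {v} \<and> i v = 1) then - 1 else s e)" for e
    have s': "\<forall>e. s' e = 1 \<or> s' e = - 1" using s by (simp add: s'_def)
    have i': "(\<Sum>e\<in>edges G - N. s' e * incidence (ends G e) v) = i v" for v
      unfolding i_def by (rule sum.cong[OF refl]) (simp add: s'_def)
    show ?thesis
    proof (rule subgraph_of_signing[OF G s'])
      fix v assume v: "v \<in> verts G"
      let ?b = "\<Sum>e\<in>edges G. s' e * incidence (ends G e) v"
      have b: "?b = i v + (\<Sum>e\<in>N. s' e * incidence (ends G e) v)" by (simp add: sum_E i')
      have "even (?b - (\<Sum>e\<in>edges G. s e * incidence (ends G e) v))"
        unfolding sum_subtractf[symmetric]
      proof (rule dvd_sum)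
        fix e show "even (s' e * incidence (ends G e) v - s e * incidence (ends G e) v)"
          using spec[OF s, of e] spec[OF s', of e] by auto
      qed
      then have "[?b = (\<Sum>e\<in>edges G. s e * incidence (ends G e) v)] (mod 2 * int k)"
        by (simp add: True cong_iff_dvd_diff)
      then show "[?b = 2 * f v - int (degree G v)] (mod 2 * int k)" by (rule cong_trans[OF _ cong[OF v]])
      have iv: "\<bar>i v\<bar> \<le> 1" using bound[OF v] True by (simp add: i_def)
      have "- 1 \<le> ?b \<and> ?b \<le> 2"
      proof -
        consider (none) "(\<Sum>e\<in>N. s' e * incidence (ends G e) v) = 0"
          | (one) e where "e \<in> N" "v \<in> ends G e" "(\<Sum>e\<in>N. s' e * incidence (ends G e) v) = s' e * incidence (ends G e) v"
          using N_sum[of s' v] by blast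
        then show ?thesis
        proof cases
          case none
          then show ?thesis using b iv by linarith
        next
          case (one e)
          show ?thesis
          proof (cases "ends G e = {v}")
            case loop: True
            then have "s' e = (if i v = 1 then - 1 else 1)" using one(1) sN by (auto simp: s'_def)
            then show ?thesis using b one(3) iv loop by (auto simp: incidence_def split: if_splits)
          next
            case False
            then have "s' e = 1" using one sN by (auto simp: s'_def)
            then show ?thesis using b one(3) iv mlt_N[OF one(2) False] by simp linarith
          qed
        qed
      qed
      then show "- 2 * int k + 1 \<le> ?b" "?b \<le> 2 * int k" using True by auto
    qed
  qed
qed

end
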